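(* Let $1\le p_0<\infty$ and let $f$ and $g$ be two positive measurable functions on $\mathbb R^n$ such that, for every $w\in A_\infty$, $$\|g\|_{L^{p_0,\infty}(w)}\le \varphi(\|w\|_{A_\infty})\,\|f\|_{L^{p_0}(w)},$$ where $\varphi$ is a locally bounded function. Then, for every $0\le\alpha\le p_0$, every $0<\mu<1$, every $r>0$, every positive locally integrable function $u$ on $\mathbb R^n$ and every $y>0$, $$\lambda^u_g(y)\le C\Big(\lambda^u_{M_r f}(y)+\frac1{y^{p_0-\alpha}}\int_{\mathbb R^n} f^{p_0-\alpha}(x)\,M_\mu(u\chi_{\{g>y\}})(x)\,dx\Big),$$ where the constant $C$ is independent of $f$, $g$, $u$ and $y$ (it may depend on $n,p_0,\alpha,\mu,r,\varphi$).
   Context: $Mf(x)=\sup_{x\in Q}\frac1{|Q|}\int_Q|f|$ is the Hardy–Littlewood maximal operator (supremum over cubes $Q\subset\mathbb R^n$ containing $x$). For $\mu>0$, $M_\mu f(x)=\big(M(|f|^{1/\mu})(x)\big)^\mu$. For a function $g$ and a positive locally integrable $u$, $\lambda_g^u(y)=u(\{x: |g(x)|>y\})=\int_{\{|g|>y\}}u\,dx$. $\|g\|_{L^{p,\infty}(w)}=\sup_{y>0}y\,\lambda_g^w(y)^{1/p}$. $A_\infty=\bigcup_{p>1}A_p$, where $A_p$ are the Muckenhoupt classes, and $\|w\|_{A_\infty}=\sup_Q\big(\frac1{|Q|}\int_Qw\big)\exp\big(\frac1{|Q|}\int_Q\log w^{-1}\big)$. A function $\varphi$ on $(0,\infty)$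 is locally bounded if $\sup_{0<t<K}\varphi(t)<\infty$ for every $K>0$. *)

theory Defs
  imports "HOL-Analysis.Analysis"
begin

text \<open>Throughout, \<open>real ^ 'n\<close> is $n$-dimensional Euclidean space, and measurability and
  integrals refer to Lebesgue measure.\<close>

text \<open>Real powers on $[0,\infty]$; only exponents \<open>p \<ge> 0\<close> are used. The convention
  $x^0 = 1$ holds also at $x = 0$ and $x = \infty$, whereas \<open>0 powr 0 = 0\<close> for reals.\<close>

definition epow :: "ennreal \<Rightarrow> real \<Rightarrow> ennreal" where
  "epow x p = (if p = 0 then 1 else if x = \<infinity> then \<infinity> else ennreal (enn2real x powr p))"

definition cubes :: "(real ^ 'n) set set" where
  "cubes = {cbox a (a + vec s) | a s. 0 < s}"

definition average :: "(real ^ 'n) set \<Rightarrow> (real ^ 'n \<Rightarrow> real) \<Rightarrow> ennreal" where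
  "average Q f = (\<integral>\<^sup>+x\<in>Q. ennreal \<bar>f x\<bar> \<partial>lebesgue) / emeasure lebesgue Q"

definition maximal :: "(real ^ 'n \<Rightarrow> real) \<Rightarrow> real ^ 'n \<Rightarrow> ennreal" where
  "maximal f x = (SUP Q\<in>{Q \<in> cubes. x \<in> Q}. average Q f)"

definition maximal_pow :: "real \<Rightarrow> (real ^ 'n \<Rightarrow> real) \<Rightarrow> real ^ 'n \<Rightarrow> ennreal" where
  "maximal_pow \<mu> f x = epow (maximal (\<lambda>z. \<bar>f z\<bar> powr (1 / \<mu>)) x) \<mu>"

text \<open>Functions are taken with values in $[0,\infty]$ here, because the distribution function is
  also applied to maximal functions; for real \<open>g\<close> use \<open>\<lambda>x. ennreal \<bar>g x\<bar>\<close>.\<close>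

definition distrib_fun :: "(real ^ 'n \<Rightarrow> real) \<Rightarrow> (real ^ 'n \<Rightarrow> ennreal) \<Rightarrow> real \<Rightarrow> ennreal" where
  "distrib_fun u h y = (\<integral>\<^sup>+x\<in>{x. h x > ennreal y}. ennreal (u x) \<partial>lebesgue)"

definition Lp_norm :: "real \<Rightarrow> (real ^ 'n \<Rightarrow> real) \<Rightarrow> (real ^ 'n \<Rightarrow> real) \<Rightarrow> ennreal" where
  "Lp_norm p w f = epow (\<integral>\<^sup>+x. epow (ennreal \<bar>f x\<bar>) p * ennreal (w x) \<partial>lebesgue) (1 / p)"

definition weak_Lp_norm :: "real \<Rightarrow> (real ^ 'n \<Rightarrow> real) \<Rightarrow> (real ^ 'n \<Rightarrow> real) \<Rightarrow> ennreal" where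
  "weak_Lp_norm p w g =
     (SUP y\<in>{0<..}. ennreal y * epow (distrib_fun w (\<lambda>x. ennreal \<bar>g x\<bar>) y) (1 / p))"

definition locally_integrable :: "(real ^ 'n \<Rightarrow> real) \<Rightarrow> bool" where
  "locally_integrable u \<longleftrightarrow>
     u \<in> borel_measurable lebesgue \<and> (\<forall>K. compact K \<longrightarrow> set_integrable lebesgue K u)"

definition weight :: "(real ^ 'n \<Rightarrow> real) \<Rightarrow> bool" where
  "weight w \<longleftrightarrow> locally_integrable w \<and> (\<forall>x. 0 \<le> w x) \<and> (AE x in lebesgue. 0 < w x)"

text \<open>The exponent \<open>- 1 / (p - 1)\<close> is $1 - p'$. Where \<open>w x = 0\<close> Isabelle's negative power is
  \<open>0\<close> instead of $\infty$; this is harmless, since weights vanish only on null sets.\<close>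

definition Ap_const :: "real \<Rightarrow> (real ^ 'n \<Rightarrow> real) \<Rightarrow> ennreal" where
  "Ap_const p w =
     (SUP Q\<in>cubes. average Q w * epow (average Q (\<lambda>x. w x powr (- 1 / (p - 1)))) (p - 1))"

definition Ap :: "real \<Rightarrow> (real ^ 'n \<Rightarrow> real) set" where
  "Ap p = {w. weight w \<and> Ap_const p w < \<infinity>}"

definition Ainfty :: "(real ^ 'n \<Rightarrow> real) set" where
  "Ainfty = (\<Union>p\<in>{1<..}. Ap p)"

text \<open>For \<open>w \<in> Ainfty\<close> the function $\log w^{-1}$ is locally integrable and the supremum is finite,
  so neither the Bochner integral nor \<open>enn2real\<close> takes its default value.\<close>

definition Ainfty_const :: "(real ^ 'n \<Rightarrow> real) \<Rightarrow> real" where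
  "Ainfty_const w = enn2real (SUP Q\<in>cubes. average Q w *
     ennreal (exp ((LINT x:Q|lebesgue. ln (inverse (w x))) / measure lebesgue Q)))"

definition locally_bounded :: "(real \<Rightarrow> real) \<Rightarrow> bool" where
  "locally_bounded \<phi> \<longleftrightarrow> (\<forall>K>0. bdd_above (\<phi> ` {0<..<K}))"

end

theory Submission
  imports Defs
begin

text \<open>The hypothesis is applied to the weight \<open>w = M\<^sub>\<mu> h \<cdot> (M\<^sub>r f) powr (- \<alpha>)\<close> with \<open>h = u \<cdot> indicator {g > y}\<close>.
  By Coifman and Rochberg, powers of maximal functions with exponent below 1 are \<open>A\<^sub>1\<close> weights with
  constants independent of the function, so \<open>w\<close> is in some \<open>A\<^sub>p\<close> with \<open>p\<close> and the constant depending
  only on the parameters, and Jensen's inequality bounds the \<open>A\<^sub>\<infinity>\<close> constant by the \<open>A\<^sub>p\<close> constant.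
  On \<open>{g > y, M\<^sub>r f \<le> y}\<close> one has \<open>u \<le> M\<^sub>\<mu> h \<le> y powr \<alpha> \<cdot> w\<close> almost everywhere, while
  \<open>f powr p\<^sub>0 \<cdot> w \<le> f powr (p\<^sub>0 - \<alpha>) \<cdot> M\<^sub>\<mu> h\<close> because \<open>f \<le> M\<^sub>r f\<close>. Replacing \<open>u\<close> by \<open>min u N\<close>
  keeps \<open>M\<^sub>\<mu> h\<close> finite. If \<open>M\<^sub>r f\<close> is infinite everywhere the claim is trivial, and if it
  vanishes somewhere then \<open>f = 0\<close>, and \<open>w = 1\<close> gives \<open>g \<le> y\<close> almost everywhere.\<close>


subsection \<open>Cubes and semicontinuity of the maximal function\<close>

text \<open>As a simp rule it would rewrite Lebesgue measures to \<open>lborel\<close> measures of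
  main parts, away from the form used below.\<close>

declare emeasure_completion [simp del]

lemma emeasure_cube:
  fixes a :: "real ^ 'n"
  assumes "0 \<le> s"
  shows "emeasure lebesgue (cbox a (a + vec s)) = ennreal (s ^ CARD('n))"
    and "emeasure lebesgue (box a (a + vec s)) = ennreal (s ^ CARD('n))"
proof -
  have le: "a \<bullet> b \<le> (a + vec s) \<bullet> b" if "b \<in> Basis" for b
    using assms that by (auto simp: Basis_vec_def inner_axis)
  have "(\<Prod>b\<in>Basis. (a + vec s - a) \<bullet> b) = (\<Prod>b\<in>(Basis :: (real ^ 'n) set). s)"
    by (rule prod.cong) (auto simp: Basis_vec_def inner_axis)
  also have "\<dots> = s ^ CARD('n)"
    by simp
  finally have eq: "(\<Prod>b\<in>Basis. (a + vec s - a) \<bullet> b) = s ^ CARD('n)" .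
  show "emeasure lebesgue (cbox a (a + vec s)) = ennreal (s ^ CARD('n))"
    using emeasure_lborel_cbox[OF le] eq by (simp add: emeasure_completion)
  show "emeasure lebesgue (box a (a + vec s)) = ennreal (s ^ CARD('n))"
    using emeasure_lborel_box[OF le] eq by (simp add: emeasure_completion)
qed

lemma cubesI: "0 < s \<Longrightarrow> cbox a (a + vec s) \<in> cubes"
  by (auto simp: cubes_def)

lemma cubesE:
  assumes "Q \<in> cubes"
  obtains a s where "0 < s" "Q = cbox a (a + vec s)"
  using assms by (auto simp: cubes_def)

lemma sets_cubes: "Q \<in> cubes \<Longrightarrow> Q \<in> sets lebesgue"
  by (auto simp: cubes_def)

lemma emeasure_cubes:
  fixes Q :: "(real ^ 'n) set"
  assumes "Q \<in> cubes"
  shows "emeasure lebesgue Q \<noteq> 0" "emeasure lebesgue Q \<noteq> \<infinity>"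
  using assms by (auto simp: emeasure_cube elim!: cubesE)

lemma mem_cube: "x \<in> cbox a (a + vec s) \<longleftrightarrow> (\<forall>i. a $ i \<le> x $ i \<and> x $ i \<le> a $ i + s)"
  for x :: "real ^ 'n"
  by (simp add: mem_box_cart)

text \<open>The undivided form: estimates are carried out on integrals over cubes, so that division
  in \<open>ennreal\<close> is met only here and in \<open>average_le\<close>.\<close>

lemma nn_integral_eq_average:
  assumes "Q \<in> cubes"
  shows "(\<integral>\<^sup>+x\<in>Q. ennreal \<bar>f x\<bar> \<partial>lebesgue) = average Q f * emeasure lebesgue Q"
  unfolding average_def
  using emeasure_cubes[OF assms] by (simp add: ennreal_divide_times ennreal_divide_self top.not_eq_extremum)

lemma average_le:
  assumes "Q \<in> cubes" and "(\<integral>\<^sup>+x\<in>Q. ennreal \<bar>f x\<bar> \<partial>lebesgue) \<le> c * emeasure lebesgue Q"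
  shows "average Q f \<le> c"
  unfolding average_def
  using assms emeasure_cubes[OF assms(1)] by (intro divide_le_posI_ennreal) (auto simp: zero_less_iff_neq_zero mult.commute)

lemma average_le_maximal: "Q \<in> cubes \<Longrightarrow> x \<in> Q \<Longrightarrow> average Q f \<le> maximal f x"
  unfolding maximal_def by (rule SUP_upper) auto

lemma nn_integral_le_maximal:
  "Q \<in> cubes \<Longrightarrow> x \<in> Q \<Longrightarrow>
    (\<integral>\<^sup>+x\<in>Q. ennreal \<bar>f x\<bar> \<partial>lebesgue) \<le> maximal f x * emeasure lebesgue Q"
  by (simp add: nn_integral_eq_average mult_right_mono average_le_maximal)

lemma maximal_leI:
  assumes "\<And>Q. Q \<in> cubes \<Longrightarrow> x \<in> Q \<Longrightarrow>
    (\<integral>\<^sup>+x\<in>Q. ennreal \<bar>f x\<bar> \<partial>lebesgue) \<le> c * emeasure lebesgue Q"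
  shows "maximal f x \<le> c"
  unfolding maximal_def using assms by (auto intro!: SUP_least average_le)

lemma less_maximalE:
  assumes "t < maximal f x"
  obtains Q where "Q \<in> cubes" "x \<in> Q"
    "t * emeasure lebesgue Q < (\<integral>\<^sup>+x\<in>Q. ennreal \<bar>f x\<bar> \<partial>lebesgue)"
  using assms maximal_leI[of x f t] by (meson linorder_not_less)

lemma maximal_mono:
  assumes "\<And>x. \<bar>f x\<bar> \<le> \<bar>g x\<bar>"
  shows "maximal f x \<le> maximal g x"
proof (rule maximal_leI)
  fix Q assume Q: "Q \<in> cubes" "x \<in> Q"
  have "(\<integral>\<^sup>+x\<in>Q. ennreal \<bar>f x\<bar> \<partial>lebesgue) \<le> (\<integral>\<^sup>+x\<in>Q. ennreal \<bar>g x\<bar> \<partial>lebesgue)"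
    using assms by (intro nn_integral_mono mult_right_mono ennreal_leI) auto
  also have "\<dots> \<le> maximal g x * emeasure lebesgue Q"
    using Q by (rule nn_integral_le_maximal)
  finally show "(\<integral>\<^sup>+x\<in>Q. ennreal \<bar>f x\<bar> \<partial>lebesgue) \<le> maximal g x * emeasure lebesgue Q" .
qed

lemma exists_cube_superset:
  fixes Q :: "(real ^ 'n) set"
  assumes "Q \<in> cubes"
  obtains R where "R \<in> cubes" "Q \<subseteq> R" "z \<in> R"
proof -
  obtain a s where Q: "0 < s" "Q = cbox a (a + vec s)"
    using assms by (rule cubesE)
  define d where "d = norm (z - a)"
  have d: "\<bar>z $ i - a $ i\<bar> \<le> d" for i
    unfolding d_def using component_le_norm_cart[of "z - a" i] by simp
  \<comment> \<open>Every coordinate of z is within d of that of the corner a, so extending Q by d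
    on each side captures z.\<close>
  let ?R = "cbox (a - vec d) ((a - vec d) + vec (s + 2 * d))"
  have "0 \<le> d" by (simp add: d_def)
  show ?thesis
  proof
    show "?R \<in> cubes"
      using Q \<open>0 \<le> d\<close> by (intro cubesI) simp
    show "Q \<subseteq> ?R"
      using Q \<open>0 \<le> d\<close> unfolding Q(2) subset_iff mem_cube
      by (auto simp: algebra_simps) (smt (verit))+
    have "a $ i \<le> d + z $ i \<and> z $ i \<le> a $ i + (d + s)" for i
      using d[of i] Q by arith
    then show "z \<in> ?R"
      unfolding mem_cube by (auto simp: algebra_simps)
  qed
qed

text \<open>Any cube through z lies in a cube through x, over which the integral of |f| is 0. So M f
  vanishes everywhere or nowhere, which decides whether its powers can serve as weights.\<close>

lemma maximal_eq_0:
  assumes "maximal f x = 0"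
  shows "maximal f z = 0"
proof -
  have "maximal f z \<le> 0"
  proof (rule maximal_leI)
    fix Q :: "(real ^ 'a) set" assume Q: "Q \<in> cubes" "z \<in> Q"
    obtain R where R: "R \<in> cubes" "Q \<subseteq> R" "x \<in> R"
      using exists_cube_superset[OF Q(1)] by blast
    have "(\<integral>\<^sup>+x\<in>Q. ennreal \<bar>f x\<bar> \<partial>lebesgue) \<le> (\<integral>\<^sup>+x\<in>R. ennreal \<bar>f x\<bar> \<partial>lebesgue)"
      using R(2) by (intro nn_set_integral_set_mono) auto
    also have "\<dots> \<le> 0"
      using nn_integral_le_maximal[OF R(1,3), of f] assms by simp
    finally show "(\<integral>\<^sup>+x\<in>Q. ennreal \<bar>f x\<bar> \<partial>lebesgue) \<le> 0 * emeasure lebesgue Q" by simp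
  qed
  then show ?thesis by simp
qed

text \<open>A closed cube containing \<open>x\<close> can be enlarged slightly to contain a neighbourhood of \<open>x\<close>.\<close>

lemma open_less_maximal:
  fixes f :: "real ^ 'n \<Rightarrow> real"
  shows "open {x. t < maximal f x}"
proof (subst open_subopen, clarify)
  fix x :: "real ^ 'n" assume t: "t < maximal f x"
  obtain Q where Q: "Q \<in> cubes" "x \<in> Q"
    "t * emeasure lebesgue Q < (\<integral>\<^sup>+x\<in>Q. ennreal \<bar>f x\<bar> \<partial>lebesgue)"
    using t by (rule less_maximalE)
  obtain a s where s: "0 < s" "Q = cbox a (a + vec s)"
    using Q(1) by (rule cubesE)
  obtain t' where t': "t = ennreal t'" "0 \<le> t'"
    using t by (cases t) auto
  let ?n = "CARD('n)"
  \<comment> \<open>The volume of the enlarged cube is continuous in e, so the strict inequality for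
    Q persists with the larger volume for some e > 0.\<close>
  have "((\<lambda>e. ennreal (t' * (s + 2 * e) ^ ?n)) \<longlongrightarrow> ennreal (t' * (s + 2 * 0) ^ ?n)) (at_right 0)"
    by (intro tendsto_intros)
  moreover have "ennreal (t' * (s + 2 * 0) ^ ?n) < (\<integral>\<^sup>+x\<in>Q. ennreal \<bar>f x\<bar> \<partial>lebesgue)"
    using Q(3) s t' by (simp add: emeasure_cube ennreal_mult)
  ultimately have "\<forall>\<^sub>F e in at_right 0. ennreal (t' * (s + 2 * e) ^ ?n) < (\<integral>\<^sup>+x\<in>Q. ennreal \<bar>f x\<bar> \<partial>lebesgue)"
    by (rule order_tendstoD)
  then have "\<forall>\<^sub>F e in at_right 0. 0 < e \<and> ennreal (t' * (s + 2 * e) ^ ?n) < (\<integral>\<^sup>+x\<in>Q. ennreal \<bar>f x\<bar> \<partial>lebesgue)"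
    using eventually_at_right_less[of 0] by eventually_elim auto
  then obtain e where e: "0 < e" "ennreal (t' * (s + 2 * e) ^ ?n) < (\<integral>\<^sup>+x\<in>Q. ennreal \<bar>f x\<bar> \<partial>lebesgue)"
    using eventually_happens[of _ "at_right (0::real)"] by auto
  let ?a = "a - vec e" and ?s = "s + 2 * e"
  let ?R = "cbox ?a (?a + vec ?s)"
  have R: "?R \<in> cubes"
    using s e by (intro cubesI) simp
  have "Q \<subseteq> box ?a (?a + vec ?s)"
    using e unfolding s(2) subset_iff mem_cube mem_box_cart
    by (auto simp: algebra_simps) (smt (verit))+
  moreover have sub: "box ?a (?a + vec ?s) \<subseteq> ?R"
    by (rule box_subset_cbox)
  ultimately have QR: "Q \<subseteq> ?R" and x: "x \<in> box ?a (?a + vec ?s)"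
    using Q(2) by auto
  have "t < maximal f z" if "z \<in> box ?a (?a + vec ?s)" for z
  proof -
    have z: "z \<in> ?R" using that sub by auto
    have "t * emeasure lebesgue ?R < (\<integral>\<^sup>+x\<in>Q. ennreal \<bar>f x\<bar> \<partial>lebesgue)"
      using e s t' by (simp add: emeasure_cube ennreal_mult)
    also have "\<dots> \<le> (\<integral>\<^sup>+x\<in>?R. ennreal \<bar>f x\<bar> \<partial>lebesgue)"
      using QR by (intro nn_set_integral_set_mono) auto
    also have "\<dots> \<le> maximal f z * emeasure lebesgue ?R"
      by (rule nn_integral_le_maximal[OF R z])
    finally show "t < maximal f z"
      by (meson linorder_not_less mult_right_mono zero_le)
  qed
  then show "\<exists>T. open T \<and> x \<in> T \<and> T \<subseteq> {x. t < maximal f x}"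
    using x by (intro exI[of _ "box ?a (?a + vec ?s)"]) auto
qed

lemma measurable_maximal [measurable]:
  "maximal f \<in> borel_measurable lebesgue"
proof (rule borel_measurableI_greater)
  fix t show "{x \<in> space lebesgue. t < maximal f x} \<in> sets lebesgue"
    using open_less_maximal[of t f] by (simp add: lborelD)
qed

subsection \<open>Weak type and almost everywhere domination\<close>

text \<open>Vitali's covering argument: each point of the level set lies in a cube whose integral
  exceeds t times its volume. Disjoint cubes are selected whose enlargements still cover the level
  set, and their integrals add up to at most that of |f|.\<close>

theorem maximal_weak_type:
  obtains K where "0 < K"
    "\<And>(f :: real ^ 'n \<Rightarrow> real) t. f \<in> borel_measurable lebesgue \<Longrightarrow> 0 < t \<Longrightarrow>
      ennreal t * emeasure lebesgue {x. ennreal t < maximal f x} \<le> ennreal K * (\<integral>\<^sup>+x. ennreal \<bar>f x\<bar> \<partial>lebesgue)"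
proof
  let ?n = "CARD('n)"
  \<comment> \<open>The ratio of the volumes of \<open>R x\<close>, of side 10 n s, and
    \<open>Q x\<close>, of side s.\<close>
  define K where "K = (10 * real ?n) ^ ?n"
  show "0 < K" by (simp add: K_def)
  fix f :: "real ^ 'n \<Rightarrow> real" and t :: real
  assume [measurable]: "f \<in> borel_measurable lebesgue" and t: "0 < t"
  let ?I = "\<integral>\<^sup>+x. ennreal \<bar>f x\<bar> \<partial>lebesgue"
  let ?S = "{x. ennreal t < maximal f x}"
  show "ennreal t * emeasure lebesgue ?S \<le> ennreal K * ?I"
  proof (cases "?I = \<infinity>")
    case True
    then show ?thesis using \<open>0 < K\<close> by (simp add: ennreal_mult_top)
  next
    case False
    then obtain I where I: "?I = ennreal I" "0 \<le> I" by (cases ?I) auto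
    \<comment> \<open>With |f| as a density, the integrals over the disjoint selected cubes sum to
      the measure of their union.\<close>
    define \<nu> where "\<nu> = density lebesgue (\<lambda>x. ennreal \<bar>f x\<bar>)"
    have \<nu>: "emeasure \<nu> Q = (\<integral>\<^sup>+x\<in>Q. ennreal \<bar>f x\<bar> \<partial>lebesgue)" if "Q \<in> sets lebesgue" for Q
      unfolding \<nu>_def using that by (intro emeasure_density) auto
    have "\<exists>a s. 0 < s \<and> x \<in> cbox a (a + vec s) \<and>
        ennreal t * ennreal (s ^ ?n) < emeasure \<nu> (cbox a (a + vec s))" if "x \<in> ?S" for x
    proof -
      have "ennreal t < maximal f x" using that by simp
      then obtain Q where "Q \<in> cubes" "x \<in> Q"
        "t * emeasure lebesgue Q < (\<integral>\<^sup>+x\<in>Q. ennreal \<bar>f x\<bar> \<partial>lebesgue)"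
        by (rule less_maximalE)
      then obtain a s where "0 < s" "x \<in> cbox a (a + vec s)"
        "t * emeasure lebesgue (cbox a (a + vec s)) < emeasure \<nu> (cbox a (a + vec s))"
        using \<nu> sets_cubes by (elim cubesE) auto
      then show ?thesis
        by (intro exI[of _ a] exI[of _ s]) (simp add: emeasure_cube)
    qed
    then obtain a s where as: "\<And>x. x \<in> ?S \<Longrightarrow> 0 < s x"
        "\<And>x. x \<in> ?S \<Longrightarrow> x \<in> cbox (a x) (a x + vec (s x))"
        "\<And>x. x \<in> ?S \<Longrightarrow> ennreal t * ennreal (s x ^ ?n) < emeasure \<nu> (cbox (a x) (a x + vec (s x)))"
      by metis
    define Q where "Q x = cbox (a x) (a x + vec (s x))" for x
    \<comment> \<open>The selection works with balls. The l1 bound for the norm shows that this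
      radius suffices for a ball centred at the corner \<open>a x\<close> to contain
      \<open>Q x\<close>.\<close>
    define \<rho> where "\<rho> x = real ?n * s x" for x
    have Q_ball: "Q x \<subseteq> cball (a x) (\<rho> x)" if "x \<in> ?S" for x
    proof
      fix z assume "z \<in> Q x"
      then have *: "\<And>i. \<bar>(a x - z) $ i\<bar> \<le> s x"
        unfolding Q_def mem_cube by (simp add: abs_le_iff) (smt (verit))
      have "norm (a x - z) \<le> (\<Sum>i\<in>UNIV. \<bar>(a x - z) $ i\<bar>)"
        by (rule norm_le_l1_cart)
      also have "\<dots> \<le> (\<Sum>i\<in>(UNIV::'n set). s x)"
        by (intro sum_mono *)
      finally show "z \<in> cball (a x) (\<rho> x)" by (simp add: \<rho>_def dist_norm)
    qed
    \<comment> \<open>Vitali's lemma requires bounded radii. If s x > 1, then s x is at most its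
      n-th power, which is below I / t because the total mass is I.\<close>
    have s_le: "s x \<le> 1 + I / t" if "x \<in> ?S" for x
    proof (cases "s x \<le> 1")
      case True
      moreover have "0 \<le> I / t" using I t by simp
      ultimately show ?thesis by linarith
    next
      case s1: False
      have "ennreal (t * s x ^ ?n) < emeasure \<nu> (Q x)"
        using as(1,3)[OF that] t by (simp add: ennreal_mult Q_def)
      also have "\<dots> \<le> emeasure \<nu> UNIV"
        unfolding Q_def \<nu>_def by (intro emeasure_mono) auto
      also have "\<dots> = ennreal I"
        using I by (subst \<nu>) auto
      finally have "t * s x ^ ?n < I"
        using t as(1)[OF that] by (simp add: ennreal_less_iff)
      then have "s x ^ ?n < I / t"
        using t by (simp add: field_simps)
      moreover have "s x \<le> s x ^ ?n"
        using s1 by (intro self_le_power) auto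
      ultimately show ?thesis by linarith
    qed
    have "?S \<subseteq> (\<Union>x\<in>?S. cball (a x) (\<rho> x))"
      using Q_ball as(2) unfolding Q_def by blast
    moreover have "0 < \<rho> x \<and> \<rho> x \<le> ?n * (1 + I / t)" if "x \<in> ?S" for x
      using as(1)[OF that] s_le[OF that] by (simp add: \<rho>_def)
    ultimately obtain C where C: "countable C" "C \<subseteq> ?S"
        "pairwise (\<lambda>i j. disjnt (cball (a i) (\<rho> i)) (cball (a j) (\<rho> j))) C"
        "?S \<subseteq> (\<Union>i\<in>C. cball (a i) (5 * \<rho> i))"
      by (rule Vitali_covering_lemma_cballs) blast
    \<comment> \<open>The cube of half-side 5 \<rho> centred at \<open>a x\<close>, circumscribed
      about the fivefold ball.\<close>
    define R where "R x = cbox (a x - vec (5 * \<rho> x)) (a x - vec (5 * \<rho> x) + vec (10 * \<rho> x))" for x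
    have ball_R: "cball (a x) (5 * \<rho> x) \<subseteq> R x" for x
    proof
      fix z assume z: "z \<in> cball (a x) (5 * \<rho> x)"
      have "\<bar>a x $ i - z $ i\<bar> \<le> 5 * \<rho> x" for i
        using component_le_norm_cart[of "a x - z" i] z by (simp add: dist_norm)
      then show "z \<in> R x"
        unfolding R_def mem_cube by (simp add: abs_le_iff) (smt (verit))
    qed
    have R_sets: "R x \<in> sets lebesgue" "Q x \<in> sets lebesgue" for x by (auto simp: R_def Q_def)
    have ne: "t * emeasure lebesgue (R x) \<le> ennreal K * emeasure \<nu> (Q x)" if "x \<in> ?S" for x
    proof -
      have "t * emeasure lebesgue (R x) = ennreal K * (t * ennreal (s x ^ ?n))"
        using as(1)[OF that] t
        by (simp add: R_def emeasure_cube \<rho>_def K_def flip: ennreal_mult)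
          (simp add: power_mult_distrib algebra_simps)
      also have "\<dots> \<le> ennreal K * emeasure \<nu> (Q x)"
        using as(3)[OF that] unfolding Q_def by (intro mult_left_mono) auto
      finally show ?thesis .
    qed
    have disj: "disjoint_family_on Q C"
      using C(3) Q_ball C(2) unfolding disjoint_family_on_def pairwise_def disjnt_def by blast
    have S_sets: "?S \<in> sets lebesgue"
      using open_less_maximal[of t f] by (simp add: lborelD)
    \<comment> \<open>Sums over the selected cubes are written as integrals over
      \<open>count_space C\<close>, so that sum and integral can be exchanged.\<close>
    have "ennreal t * emeasure lebesgue ?S = (\<integral>\<^sup>+x. ennreal t * indicator ?S x \<partial>lebesgue)"
      using S_sets by (simp add: nn_integral_cmult_indicator)
    also have "\<dots> \<le> (\<integral>\<^sup>+x. \<integral>\<^sup>+i. ennreal t * indicator (R i) x \<partial>count_space C \<partial>lebesgue)"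
    proof (intro nn_integral_mono)
      fix x
      show "ennreal t * indicator ?S x \<le> (\<integral>\<^sup>+i. ennreal t * indicator (R i) x \<partial>count_space C)"
      proof (cases "x \<in> ?S")
        case True
        then obtain i where i: "i \<in> C" "x \<in> R i" using C(4) ball_R by blast
        then show ?thesis
          using nn_integral_ge_point[of i C "\<lambda>i. ennreal t * indicator (R i) x"] True by simp
      qed auto
    qed
    also have "\<dots> = (\<integral>\<^sup>+i. \<integral>\<^sup>+x. ennreal t * indicator (R i) x \<partial>lebesgue \<partial>count_space C)"
      using C(1) R_sets by (intro nn_integral_count_space_nn_integral) auto
    also have "\<dots> = (\<integral>\<^sup>+i. ennreal t * emeasure lebesgue (R i) \<partial>count_space C)"
      using R_sets by (simp add: nn_integral_cmult_indicator)
    also have "\<dots> \<le> (\<integral>\<^sup>+i. ennreal K * emeasure \<nu> (Q i) \<partial>count_space C)"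
      using C(2) by (intro nn_integral_mono ne) auto
    also have "\<dots> = ennreal K * (\<integral>\<^sup>+i. emeasure \<nu> (Q i) \<partial>count_space C)"
      by (rule nn_integral_cmult) auto
    also have "(\<integral>\<^sup>+i. emeasure \<nu> (Q i) \<partial>count_space C) = emeasure \<nu> (\<Union>i\<in>C. Q i)"
      using C(1) disj R_sets by (intro emeasure_UN_countable[symmetric]) (auto simp: \<nu>_def)
    also have "\<dots> \<le> emeasure \<nu> UNIV"
      unfolding \<nu>_def by (intro emeasure_mono) auto
    also have "\<dots> = ?I"
      by (subst \<nu>) auto
    finally show ?thesis by (simp add: mult_left_mono)
  qed
qed


text \<open>Nonoverlapping cubes that meet E cover it inside an open U of measure at most |E| + e.
  Each contains a point where M f \<le> a, so |f| integrates to at most a times its volume. Summing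
  gives b |E| \<le> a (|E| + e), and letting e tend to 0 forces |E| = 0.\<close>

lemma null_sets_maximal_gap:
  fixes f :: "real ^ 'n \<Rightarrow> real"
  assumes [measurable]: "f \<in> borel_measurable lebesgue" and ab: "0 \<le> a" "a < b" and k: "0 < k"
  shows "{x \<in> cbox (- vec k) (vec k). b < \<bar>f x\<bar> \<and> maximal f x \<le> ennreal a} \<in> null_sets lebesgue"
    (is "?E \<in> _")
proof -
  let ?B = "cbox (- vec k) (vec k) :: (real ^ 'n) set"
  have E: "?E \<in> sets lebesgue"
  proof -
    have "?E = ?B \<inter> {x \<in> space lebesgue. b < \<bar>f x\<bar> \<and> maximal f x \<le> ennreal a}"
      by auto
    also have "\<dots> \<in> sets lebesgue"
      by (rule sets.Int[OF lmeasurable_cbox[THEN fmeasurableD]]) measurable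
    finally show ?thesis .
  qed
  have "emeasure lebesgue ?E \<le> emeasure lebesgue ?B"
    by (intro emeasure_mono) auto
  also have "\<dots> < \<infinity>"
    using lmeasurable_cbox[of "- vec k" "vec k :: real ^ 'n"] unfolding fmeasurable_def by simp
  finally obtain m where m: "emeasure lebesgue ?E = ennreal m" "0 \<le> m"
    by (cases "emeasure lebesgue ?E") auto
  have "b * m \<le> a * (m + e)" if e: "0 < e" for e
  proof -
    obtain U where U: "open U" "?E \<subseteq> U" "U - ?E \<in> lmeasurable" "emeasure lebesgue (U - ?E) < ennreal e"
      by (rule sets_lebesgue_outer_open[OF E e]) (rule that)
    have "emeasure lebesgue U = emeasure lebesgue ?E + emeasure lebesgue (U - ?E)"
      using U E by (subst plus_emeasure) (auto intro!: arg_cong2[where f=emeasure])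
    also have "\<dots> \<le> ennreal m + ennreal e"
      using U m by (intro add_mono) auto
    also have "\<dots> = ennreal (m + e)"
      using m e by simp
    finally have U_le: "emeasure lebesgue U \<le> ennreal (m + e)" .
    \<comment> \<open>The cubes are tagged by points of E, which lie in U, so this gauge keeps them
      inside U; off U any neighbourhood is allowed.\<close>
    define g where "g x = (if x \<in> U then U else UNIV)" for x
    have "gauge g"
      using U by (auto simp: gauge_def g_def)
    have box_ne: "box (- vec k) (vec k :: real ^ 'n) \<noteq> {}"
      using k by (auto simp: interval_ne_empty_cart)
    have E_sub: "?E \<subseteq> ?B" by auto
    obtain D where D: "countable D" "\<Union>D \<subseteq> ?B"
      "\<And>K. K \<in> D \<Longrightarrow> interior K \<noteq> {} \<and> (\<exists>c d. K = cbox c d)"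
      "pairwise (\<lambda>A B. interior A \<inter> interior B = {}) D"
      "\<And>K. K \<in> D \<Longrightarrow> \<exists>x \<in> ?E \<inter> K. K \<subseteq> g x"
      "\<And>u v. cbox u v \<in> D \<Longrightarrow> \<exists>n. \<forall>i\<in>Basis. v \<bullet> i - u \<bullet> i = (vec k \<bullet> i - (- vec k) \<bullet> i) / 2 ^ n"
      "?E \<subseteq> \<Union>D"
      by (rule covering_lemma[OF E_sub box_ne \<open>gauge g\<close>]) (rule that)
    \<comment> \<open>The boxes of the covering lemma have the proportions of the surrounding box.
      That one is a cube of side 2 k, so all sides are 2 k / 2 ^ j with a single j.\<close>
    have D_cubes: "K \<in> cubes" if K_D: "K \<in> D" for K
    proof -
      obtain u v where K: "K = cbox u v"
        using D(3)[OF K_D] by blast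
      obtain j :: nat where j: "\<And>i. i \<in> Basis \<Longrightarrow> v \<bullet> i - u \<bullet> i = (vec k \<bullet> i - (- vec k) \<bullet> i) / 2 ^ j"
        using D(6) K_D K by blast
      have "v = u + vec (2 * k / 2 ^ j)"
      proof (rule euclidean_eqI)
        fix i :: "real ^ 'n" assume i: "i \<in> Basis"
        then show "v \<bullet> i = (u + vec (2 * k / 2 ^ j)) \<bullet> i"
          using j[OF i] by (auto simp: Basis_vec_def inner_axis inner_add_left)
      qed
      then show ?thesis
        using K k by (auto intro!: cubesI)
    qed
    have D_sets: "K \<in> sets lebesgue" if "K \<in> D" for K
      using D_cubes[OF that] by (rule sets_cubes)
    \<comment> \<open>Only the interiors are disjoint. Faces are null sets, so measures can be
      computed on the interiors.\<close>
    have D_int: "emeasure lebesgue K = emeasure lebesgue (interior K)" if "K \<in> D" for K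
      using D_cubes[OF that] by (elim cubesE) (simp add: emeasure_cube)
    have D_E: "(\<integral>\<^sup>+x\<in>K. ennreal \<bar>f x\<bar> \<partial>lebesgue) \<le> ennreal a * emeasure lebesgue K" and D_U: "K \<subseteq> U"
      if K: "K \<in> D" for K
    proof -
      obtain x where x: "x \<in> ?E" "x \<in> K" "K \<subseteq> g x"
        using D(5)[OF K] by blast
      then show "K \<subseteq> U"
        using U(2) by (auto simp: g_def split: if_splits)
      have "(\<integral>\<^sup>+x\<in>K. ennreal \<bar>f x\<bar> \<partial>lebesgue) \<le> maximal f x * emeasure lebesgue K"
        using D_cubes[OF K] x(2) by (rule nn_integral_le_maximal)
      also have "\<dots> \<le> ennreal a * emeasure lebesgue K"
        using x(1) by (intro mult_right_mono) auto
      finally show "(\<integral>\<^sup>+x\<in>K. ennreal \<bar>f x\<bar> \<partial>lebesgue) \<le> ennreal a * emeasure lebesgue K" .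
    qed
    have disj: "disjoint_family_on interior D"
      using D(4) by (auto simp: disjoint_family_on_def pairwise_def)
    have "ennreal b * emeasure lebesgue ?E = (\<integral>\<^sup>+x. ennreal b * indicator ?E x \<partial>lebesgue)"
      using E by (simp add: nn_integral_cmult_indicator)
    also have "\<dots> \<le> (\<integral>\<^sup>+x. \<integral>\<^sup>+K. ennreal \<bar>f x\<bar> * indicator K x \<partial>count_space D \<partial>lebesgue)"
    proof (intro nn_integral_mono)
      fix x
      show "ennreal b * indicator ?E x \<le> (\<integral>\<^sup>+K. ennreal \<bar>f x\<bar> * indicator K x \<partial>count_space D)"
      proof (cases "x \<in> ?E")
        case True
        then obtain K where K: "K \<in> D" "x \<in> K" using D(7) by blast
        have "ennreal b * indicator ?E x \<le> ennreal \<bar>f x\<bar> * indicator K x"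
          using True K by (auto intro!: ennreal_leI)
        also have "\<dots> \<le> (\<integral>\<^sup>+K. ennreal \<bar>f x\<bar> * indicator K x \<partial>count_space D)"
          using nn_integral_ge_point[of K D "\<lambda>K. ennreal \<bar>f x\<bar> * indicator K x"] K by simp
        finally show ?thesis .
      qed auto
    qed
    also have "\<dots> = (\<integral>\<^sup>+K. \<integral>\<^sup>+x. ennreal \<bar>f x\<bar> * indicator K x \<partial>lebesgue \<partial>count_space D)"
      using D(1) D_sets by (intro nn_integral_count_space_nn_integral) auto
    also have "\<dots> \<le> (\<integral>\<^sup>+K. ennreal a * emeasure lebesgue (interior K) \<partial>count_space D)"
      using D_E D_int by (intro nn_integral_mono) auto
    also have "\<dots> = ennreal a * (\<integral>\<^sup>+K. emeasure lebesgue (interior K) \<partial>count_space D)"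
      by (rule nn_integral_cmult) auto
    also have "(\<integral>\<^sup>+K. emeasure lebesgue (interior K) \<partial>count_space D) = emeasure lebesgue (\<Union>K\<in>D. interior K)"
      using D(1) disj by (intro emeasure_UN_countable[symmetric]) auto
    also have "\<dots> \<le> emeasure lebesgue U"
      using D_U interior_subset U(1) by (intro emeasure_mono UN_least) auto
    also have "\<dots> \<le> ennreal (m + e)" by fact
    finally have "ennreal b * ennreal m \<le> ennreal a * ennreal (m + e)"
      using m by (simp add: mult_left_mono)
    then show ?thesis
      using ab m e by (simp flip: ennreal_mult del: ennreal_plus)
  qed
  then have "b * m \<le> a * m"
  proof -
    assume *: "\<And>e. 0 < e \<Longrightarrow> b * m \<le> a * (m + e)"
    have "b * m \<le> a * m + a * e" if "0 < e" for e
      using *[OF that] by (simp add: algebra_simps)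
    moreover have "((\<lambda>e. a * m + a * e) \<longlongrightarrow> a * m + a * 0) (at_right 0)"
      by (intro tendsto_intros)
    ultimately have "b * m \<le> a * m + a * 0"
      by (intro tendsto_lowerbound[where F="at_right 0"])
        (auto simp: eventually_at_right_less intro!: eventually_mono[OF eventually_at_right_less])
    then show ?thesis by simp
  qed
  then have "m = 0"
    using ab m by (simp add: mult_le_cancel_right)
  then show ?thesis
    using E m by auto
qed

text \<open>Where the bound fails, two rationals fit strictly between M f x and |f x|. The
  exceptional set is thus a countable union of the null sets of
  \<open>null_sets_maximal_gap\<close>.\<close>

theorem AE_le_maximal:
  fixes f :: "real ^ 'n \<Rightarrow> real"
  assumes [measurable]: "f \<in> borel_measurable lebesgue"
  shows "AE x in lebesgue. ennreal \<bar>f x\<bar> \<le> maximal f x"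
proof -
  \<comment> \<open>\<open>Suc k\<close> rather than \<open>k\<close>, because the gap lemma needs a
    cube of positive side.\<close>
  let ?E = "\<lambda>a b (k::nat). {x \<in> cbox (- vec (Suc k)) (vec (Suc k)). b < \<bar>f x\<bar> \<and> maximal f x \<le> ennreal a}"
  let ?I = "{(a, b). a \<in> \<rat> \<and> b \<in> \<rat> \<and> 0 \<le> a \<and> a < b} \<times> (UNIV :: nat set)"
  let ?N = "\<Union>((a, b), k)\<in>?I. ?E a b k"
  have "countable ?I"
    by (intro countable_SIGMA countable_subset[OF _ countable_SIGMA[OF countable_rat countable_rat]]) auto
  then have "?N \<in> null_sets lebesgue"
    by (intro null_sets_UN') (auto intro!: null_sets_maximal_gap)
  then show ?thesis
  proof (rule AE_I')
    show "{x \<in> space lebesgue. \<not> ennreal \<bar>f x\<bar> \<le> maximal f x} \<subseteq> ?N"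
    proof clarify
      fix x assume "\<not> ennreal \<bar>f x\<bar> \<le> maximal f x"
      then have "maximal f x < ennreal \<bar>f x\<bar>" by simp
      then obtain m where m: "maximal f x = ennreal m" "0 \<le> m" "m < \<bar>f x\<bar>"
        by (cases "maximal f x") (auto simp: ennreal_less_iff)
      obtain a where a: "a \<in> \<rat>" "m < a" "a < \<bar>f x\<bar>"
        using Rats_dense_in_real[OF m(3)] by blast
      obtain b where b: "b \<in> \<rat>" "a < b" "b < \<bar>f x\<bar>"
        using Rats_dense_in_real[OF a(3)] by blast
      obtain k :: nat where k: "norm x \<le> k"
        using real_arch_simple by blast
      have "\<bar>x $ i\<bar> \<le> 1 + real k" for i
        using component_le_norm_cart[of x i] k by linarith
      then have "x \<in> cbox (- vec (Suc k)) (vec (Suc k))"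
        by (auto simp: mem_box_cart abs_le_iff) (smt (verit))+
      then have "x \<in> ?E a b k"
        using a b m by (auto intro!: ennreal_leI)
      moreover have "((a, b), k) \<in> ?I"
        using a b m by auto
      ultimately show "x \<in> ?N"
        by (intro UN_I[of "((a, b), k)"]) simp_all
    qed
  qed
qed


subsection \<open>Powers of maximal functions\<close>

lemma epow_ennreal: "0 \<le> a \<Longrightarrow> 0 < p \<Longrightarrow> epow (ennreal a) p = ennreal (a powr p)"
  by (simp add: epow_def)

lemma epow_0_right [simp]: "epow x 0 = 1"
  by (simp add: epow_def)

lemma epow_0_left: "0 < p \<Longrightarrow> epow 0 p = 0"
  by (simp add: epow_def)

lemma epow_top: "0 < p \<Longrightarrow> epow \<infinity> p = \<infinity>"
  by (simp add: epow_def)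

lemma epow_mono:
  assumes "0 \<le> p" "x \<le> y"
  shows "epow x p \<le> epow y p"
proof (cases "p = 0 \<or> y = \<infinity>")
  case False
  then have "x \<noteq> \<infinity>" using assms by (auto simp: top_unique)
  moreover have "enn2real x \<le> enn2real y"
    using assms False by (intro enn2real_mono) (auto simp: top.not_eq_extremum)
  ultimately show ?thesis
    using assms False by (auto simp: epow_def intro!: ennreal_leI powr_mono2)
qed (auto simp: epow_def)

lemma measurable_epow [measurable]:
  assumes [measurable]: "h \<in> borel_measurable M"
  shows "(\<lambda>x. epow (h x) p) \<in> borel_measurable M"
  unfolding epow_def by measurable

text \<open>A dyadic layer-cake bound. If v > T is finite, one term already suffices, namely the one
  with 2 ^ j * T < v \<le> 2 ^ Suc j * T. After integration the indicators become level sets, to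
  which the weak type bound applies.\<close>

lemma epow_le_dyadic_sum:
  assumes "0 < \<delta>" "0 < T"
  shows "epow v \<delta> \<le> ennreal (T powr \<delta>) +
    (\<Sum>j. ennreal (T powr \<delta> * (2 powr \<delta>) ^ Suc j) * indicator {w. ennreal (2 ^ j * T) < w} v)"
proof -
  let ?c = "\<lambda>j. T powr \<delta> * (2 powr \<delta>) ^ Suc j"
  let ?f = "\<lambda>j. ennreal (?c j) * indicator {w. ennreal (2 ^ j * T) < w} v"
  have c: "?c j = (2 ^ Suc j * T) powr \<delta>" for j
    using assms by (simp add: powr_mult powr_power powr_powr mult.commute flip: powr_realpow)
  have "h j \<le> (\<Sum>j. h j)" for h :: "nat \<Rightarrow> ennreal" and j
    using sum_le_suminf[OF summableI, of "{j}" h] by simp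
  note le_sum = this[of ?f]
  show ?thesis
  proof (cases v)
    case top
    \<comment> \<open>At v = \<infinity> all indicators are 1 and the terms grow geometrically with
      ratio 2 powr \<delta> > 1, so the sum exceeds every real number.\<close>
    have "ennreal r \<le> (\<Sum>j. ?f j)" for r
    proof -
      have "1 < 2 powr \<delta>" using assms by simp
      then obtain j where j: "r / T powr \<delta> < (2 powr \<delta>) ^ j"
        using real_arch_pow by blast
      also have "\<dots> \<le> (2 powr \<delta>) ^ Suc j"
        using \<open>1 < 2 powr \<delta>\<close> by (intro power_increasing) auto
      finally have "r \<le> ?c j"
        using assms by (simp add: field_simps)
      then have "ennreal r \<le> ?f j"
        using top by (auto intro!: ennreal_leI)
      then show ?thesis using le_sum[of j] by (rule order_trans)
    qed
    note unbounded = this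
    have "(\<Sum>j. ?f j) = \<infinity>"
    proof (cases "\<Sum>j. ?f j")
      case (real c)
      then show ?thesis
        using unbounded[of "c + 1"] by (simp del: ennreal_plus)
    qed simp
    then show ?thesis by simp
  next
    case (real r)
    show ?thesis
    proof (cases "r \<le> T")
      case True
      then have "epow v \<delta> \<le> ennreal (T powr \<delta>)"
        using real assms by (simp add: epow_ennreal powr_mono2 ennreal_leI)
      then show ?thesis
        by (rule order_trans) simp
    next
      case False
      define P where "P j \<longleftrightarrow> r \<le> 2 ^ Suc j * T" for j
      obtain j0 where "r / T < 2 ^ j0"
        using real_arch_pow[of 2 "r / T"] by auto
      then have "r < 2 ^ j0 * T"
        using assms by (simp add: field_simps)
      also have "\<dots> \<le> 2 ^ Suc j0 * T"
        using assms by simp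
      finally have "P j0"
        by (simp add: P_def)
      define j where "j = (LEAST j. P j)"
      have "P j"
        unfolding j_def using \<open>P j0\<close> by (rule LeastI)
      have "2 ^ j * T < r"
      proof (cases j)
        case 0
        then show ?thesis using False by simp
      next
        case (Suc i)
        then have "\<not> P i"
          unfolding j_def by (intro not_less_Least) simp
        then show ?thesis using Suc by (simp add: P_def)
      qed
      then have "ennreal (2 ^ j * T) < v"
        using real assms by (simp add: ennreal_less_iff)
      moreover have "epow v \<delta> \<le> ennreal (?c j)"
        unfolding c using \<open>P j\<close> real assms by (simp add: epow_ennreal P_def powr_mono2 ennreal_leI)
      ultimately have "epow v \<delta> \<le> ?f j" by simp
      also have "\<dots> \<le> (\<Sum>j. ?f j)" by (rule le_sum)
      finally show ?thesis
        by (rule order_trans) simp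
    qed
  qed
qed

text \<open>A cube through \<open>z\<close> that is not inside the threefold enlargement of \<open>Q\<close> is longer than \<open>Q\<close>, so
  doubling it covers \<open>Q\<close>, and its average is controlled by \<open>maximal f x\<close>.\<close>

lemma maximal_localise:
  fixes f :: "real ^ 'n \<Rightarrow> real"
  assumes [measurable]: "f \<in> borel_measurable lebesgue" and s: "0 < s"
    and x: "x \<in> cbox a (a + vec s)" and z: "z \<in> cbox a (a + vec s)"
    and \<tau>: "2 ^ CARD('n) * maximal f x \<le> \<tau>" "\<tau> < maximal f z"
  shows "\<tau> < maximal (\<lambda>y. f y * indicator (cbox (a - vec s) (a - vec s + vec (3 * s))) y) z"
    (is "_ < maximal ?f1 z")
proof -
  obtain R where R: "R \<in> cubes" "z \<in> R" "\<tau> * emeasure lebesgue R < (\<integral>\<^sup>+x\<in>R. ennreal \<bar>f x\<bar> \<partial>lebesgue)"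
    using \<tau>(2) by (rule less_maximalE)
  obtain b t where t: "0 < t" "R = cbox b (b + vec t)"
    using R(1) by (rule cubesE)
  have z': "a $ i \<le> z $ i" "z $ i \<le> a $ i + s" "b $ i \<le> z $ i" "z $ i \<le> b $ i + t" for i
    using z R(2) unfolding t mem_cube by auto
  have "t \<le> s"
  proof (rule ccontr)
    assume "\<not> t \<le> s"
    \<comment> \<open>Recentred at z and with side doubled, R is still contained, and so is x
      because s < t. The volume factor is the 2 ^ n in the hypothesis on \<tau>.\<close>
    let ?R = "cbox (z - vec t) (z - vec t + vec (2 * t))"
    have "R \<subseteq> ?R"
      unfolding t subset_iff mem_cube using z'
      by (auto simp: algebra_simps) (smt (verit))+
    have "x \<in> ?R"
      using x z' \<open>\<not> t \<le> s\<close> unfolding mem_cube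
      by (auto simp: algebra_simps) (smt (verit))+
    have "?R \<in> cubes" using t by (intro cubesI) simp
    have "(\<integral>\<^sup>+x\<in>R. ennreal \<bar>f x\<bar> \<partial>lebesgue) \<le> (\<integral>\<^sup>+x\<in>?R. ennreal \<bar>f x\<bar> \<partial>lebesgue)"
      using \<open>R \<subseteq> ?R\<close> by (intro nn_set_integral_set_mono) auto
    also have "\<dots> \<le> maximal f x * emeasure lebesgue ?R"
      by (rule nn_integral_le_maximal) fact+
    also have "emeasure lebesgue ?R = 2 ^ CARD('n) * emeasure lebesgue R"
      using t by (simp add: emeasure_cube power_mult_distrib ennreal_mult ennreal_power flip: ennreal_numeral)
    also have "maximal f x * (2 ^ CARD('n) * emeasure lebesgue R) \<le> \<tau> * emeasure lebesgue R"
      using mult_right_mono[OF \<tau>(1), of "emeasure lebesgue R"] by (simp add: mult_ac)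
    finally show False using R(3) by simp
  qed
  then have "R \<subseteq> cbox (a - vec s) (a - vec s + vec (3 * s))"
    using z' s unfolding t subset_iff mem_cube
    by (auto simp: algebra_simps) (smt (verit))+
  then have "(\<integral>\<^sup>+x\<in>R. ennreal \<bar>f x\<bar> \<partial>lebesgue) = (\<integral>\<^sup>+x\<in>R. ennreal \<bar>?f1 x\<bar> \<partial>lebesgue)"
    by (intro nn_integral_cong) (auto simp: indicator_def)
  also have "\<dots> \<le> maximal ?f1 z * emeasure lebesgue R"
    using R by (intro nn_integral_le_maximal)
  finally have "\<tau> * emeasure lebesgue R < maximal ?f1 z * emeasure lebesgue R"
    using R(3) by simp
  then show ?thesis
    by (meson linorder_not_less mult_right_mono zero_le)
qed

text \<open>Coifman and Rochberg, by Kolmogorov's argument. On Q, the level sets of M f above T = 2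
  ^ n * M f x involve only f restricted to the threefold cube. By the weak type bound their measures
  decay like 2 ^ (-j), which beats the growth 2 powr (j * \<delta>) of the values.\<close>

theorem maximal_powr_A1:
  assumes \<delta>: "0 \<le> \<delta>" "\<delta> < 1"
  obtains C where "1 \<le> C"
    "\<And>(f :: real ^ 'n \<Rightarrow> real) Q x. f \<in> borel_measurable lebesgue \<Longrightarrow> Q \<in> cubes \<Longrightarrow> x \<in> Q \<Longrightarrow>
      (\<integral>\<^sup>+z\<in>Q. epow (maximal f z) \<delta> \<partial>lebesgue) \<le> ennreal C * epow (maximal f x) \<delta> * emeasure lebesgue Q"
proof (cases "\<delta> = 0")
  case True
  show ?thesis
  proof (rule that[of 1])
    fix f :: "real ^ 'n \<Rightarrow> real"  and Q :: "(real ^ 'n) set" and x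
    assume "f \<in> borel_measurable lebesgue" "Q \<in> cubes" "x \<in> Q"
    then show "(\<integral>\<^sup>+z\<in>Q. epow (maximal f z) \<delta> \<partial>lebesgue) \<le> ennreal 1 * epow (maximal f x) \<delta> * emeasure lebesgue Q"
      using True sets_cubes[of Q] by simp
  qed simp
next
  case False
  then have \<delta>0: "0 < \<delta>" using \<delta> by simp
  obtain K where K: "0 < K"
    "\<And>(f :: real ^ 'n \<Rightarrow> real) t. f \<in> borel_measurable lebesgue \<Longrightarrow> 0 < t \<Longrightarrow>
      ennreal t * emeasure lebesgue {x. ennreal t < maximal f x} \<le> ennreal K * (\<integral>\<^sup>+x. ennreal \<bar>f x\<bar> \<partial>lebesgue)"
    by (rule maximal_weak_type) (rule that)
  let ?n = "CARD('n)"
  \<comment> \<open>The growth ratio of the dyadic values; \<delta> < 1 enters as q < 2, which makes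
    the series of ratio q / 2 converge.\<close>
  define q where "q = 2 powr \<delta>"
  have "2 powr \<delta> < 2 powr 1" using \<delta> by (intro powr_less_mono) auto
  then have q: "1 < q" "q < 2"
    using \<delta>0 by (auto simp: q_def)
  \<comment> \<open>The factor 3 ^ n is the volume ratio of the threefold cube to Q, and 2 ^ n is
    the factor in T.\<close>
  define K' where "K' = K * (3 / 2) ^ ?n"
  \<comment> \<open>The 1 accounts for the values up to T, the rest is the geometric series over the
    levels above T.\<close>
  define B where "B = 1 + K' * q * (1 / (1 - q / 2))"
  \<comment> \<open>The extra factor turns T powr \<delta> back into the power of m = M f x.\<close>
  define C where "C = (2 ^ ?n) powr \<delta> * B"
  have "0 < K'" using K by (simp add: K'_def)
  then have B: "1 \<le> B" using q by (simp add: B_def)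
  show ?thesis
  proof (rule that[of C])
    have "1 \<le> (2 ^ ?n :: real) powr \<delta>" using \<delta> by (intro ge_one_powr_ge_zero) auto
    then have "1 * 1 \<le> (2 ^ ?n) powr \<delta> * B" using B by (intro mult_mono) auto
    then show "1 \<le> C" by (simp add: C_def)
    then have "0 < C" by simp
    fix f :: "real ^ 'n \<Rightarrow> real"  and Q :: "(real ^ 'n) set" and x
    assume f[measurable]: "f \<in> borel_measurable lebesgue" and Q: "Q \<in> cubes" and x: "x \<in> Q"
    note Q_sets[measurable] = sets_cubes[OF Q]
    show "(\<integral>\<^sup>+z\<in>Q. epow (maximal f z) \<delta> \<partial>lebesgue) \<le> ennreal C * epow (maximal f x) \<delta> * emeasure lebesgue Q"
    proof (cases "maximal f x = \<infinity> \<or> maximal f x = 0")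
      case True
      then show ?thesis
      proof
        assume "maximal f x = \<infinity>"
        then show ?thesis
          using \<delta>0 \<open>0 < C\<close> emeasure_cubes[OF Q] epow_top[OF \<delta>0] by (simp add: ennreal_mult_top ennreal_top_mult)
      next
        assume "maximal f x = 0"
        then show ?thesis
          using \<delta>0 maximal_eq_0[of f x] by (simp add: epow_0_left)
      qed
    next
      case False
      then obtain m where m: "maximal f x = ennreal m" "0 < m"
        by (cases "maximal f x") (auto simp: less_le)
      obtain a s where s: "0 < s" "Q = cbox a (a + vec s)"
        using Q by (rule cubesE)
      let ?Q3 = "cbox (a - vec s) (a - vec s + vec (3 * s))"
      define f1 where "f1 = (\<lambda>y. f y * indicator ?Q3 y)"
      have Q3: "?Q3 \<in> cubes" "x \<in> ?Q3"
        using s x by (auto intro!: cubesI simp: mem_cube) (smt (verit))+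
      have f1_meas[measurable]: "f1 \<in> borel_measurable lebesgue"
        unfolding f1_def using sets_cubes[OF Q3(1)] by measurable
      define T where "T = 2 ^ ?n * m"
      have T: "0 < T" using m by (simp add: T_def)
      have "(\<integral>\<^sup>+x. ennreal \<bar>f1 x\<bar> \<partial>lebesgue) = (\<integral>\<^sup>+x\<in>?Q3. ennreal \<bar>f x\<bar> \<partial>lebesgue)"
        by (intro nn_integral_cong) (auto simp: f1_def indicator_def)
      also have "\<dots> \<le> ennreal m * emeasure lebesgue ?Q3"
        using nn_integral_le_maximal[OF Q3, of f] m by simp
      also have "\<dots> = ennreal (m * 3 ^ ?n * s ^ ?n)"
        using s m by (simp add: emeasure_cube power_mult_distrib mult.assoc flip: ennreal_mult)
      finally have f1_int: "(\<integral>\<^sup>+x. ennreal \<bar>f1 x\<bar> \<partial>lebesgue) \<le> ennreal (m * 3 ^ ?n * s ^ ?n)" .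
      define S where "S j = {z \<in> Q. ennreal (2 ^ j * T) < maximal f z}" for j :: nat
      have S_sets[measurable]: "S j \<in> sets lebesgue" for j
      proof -
        have "S j = Q \<inter> {z \<in> space lebesgue. ennreal (2 ^ j * T) < maximal f z}"
          by (auto simp: S_def)
        also have "\<dots> \<in> sets lebesgue"
          by (rule sets.Int[OF Q_sets]) measurable
        finally show ?thesis .
      qed
      have S_le: "emeasure lebesgue (S j) \<le> ennreal (K' * (1 / 2) ^ j * s ^ ?n)" for j
      proof -
        let ?t = "2 ^ j * T"
        have t: "0 < ?t" using T by simp
        have "S j \<subseteq> {z. ennreal ?t < maximal f1 z}"
        proof
          fix z assume z: "z \<in> S j"
          have "2 ^ ?n * maximal f x = ennreal T"
            using m by (simp add: T_def ennreal_mult ennreal_power flip: ennreal_numeral)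
          also have "\<dots> \<le> ennreal ?t"
            using T by (intro ennreal_leI) simp
          finally show "z \<in> {z. ennreal ?t < maximal f1 z}"
            using z s x maximal_localise[of f s x a z "ennreal ?t"] by (simp add: f1_def S_def)
        qed
        then have "ennreal ?t * emeasure lebesgue (S j) \<le> ennreal ?t * emeasure lebesgue {z. ennreal ?t < maximal f1 z}"
          using open_less_maximal[of "ennreal ?t" f1]
          by (intro mult_left_mono emeasure_mono) auto
        also have "\<dots> \<le> ennreal K * (\<integral>\<^sup>+x. ennreal \<bar>f1 x\<bar> \<partial>lebesgue)"
          by (rule K(2)[OF f1_meas t])
        also have "\<dots> \<le> ennreal K * ennreal (m * 3 ^ ?n * s ^ ?n)"
          by (intro mult_left_mono f1_int) auto
        also have "\<dots> = ennreal ?t * ennreal (K' * (1 / 2) ^ j * s ^ ?n)"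
          using K m s T \<open>0 < K'\<close>
          by (simp add: flip: ennreal_mult) (simp add: K'_def T_def field_simps power_divide)
        finally show ?thesis
          using t by (subst (asm) ennreal_mult_le_mult_iff) auto
      qed
      let ?A = "T powr \<delta>"
      have q_sums: "(\<lambda>j. ?A * q ^ Suc j * (K' * (1 / 2) ^ j * s ^ ?n)) sums (?A * (K' * q * (1 / (1 - q / 2))) * s ^ ?n)"
      proof -
        have "(\<lambda>j. (q / 2) ^ j) sums (1 / (1 - q / 2))"
          using q by (intro geometric_sums) auto
        then have "(\<lambda>j. (?A * K' * q * s ^ ?n) * (q / 2) ^ j) sums ((?A * K' * q * s ^ ?n) * (1 / (1 - q / 2)))"
          by (rule sums_mult)
        then show ?thesis
          by (simp add: power_divide mult_ac)
      qed
      have "(\<integral>\<^sup>+z\<in>Q. epow (maximal f z) \<delta> \<partial>lebesgue) \<le>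
        (\<integral>\<^sup>+z. ennreal ?A * indicator Q z + (\<Sum>j. ennreal (?A * q ^ Suc j) * indicator (S j) z) \<partial>lebesgue)"
      proof (rule nn_integral_mono)
        fix z
        show "epow (maximal f z) \<delta> * indicator Q z \<le>
          ennreal ?A * indicator Q z + (\<Sum>j. ennreal (?A * q ^ Suc j) * indicator (S j) z)"
        proof (cases "z \<in> Q")
          case True
          then have "indicator (S j) z = (indicator {w. ennreal (2 ^ j * T) < w} (maximal f z) :: ennreal)" for j
            by (simp add: S_def indicator_def)
          then show ?thesis
            using epow_le_dyadic_sum[OF \<delta>0 T, of "maximal f z"] True by (simp add: q_def)
        qed simp
      qed
      also have "\<dots> = ennreal ?A * emeasure lebesgue Q + (\<Sum>j. ennreal (?A * q ^ Suc j) * emeasure lebesgue (S j))"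
        by (subst nn_integral_add, simp_all add: nn_integral_cmult_indicator, subst nn_integral_suminf)
          (simp_all add: nn_integral_cmult_indicator)
      also have "\<dots> \<le> ennreal ?A * emeasure lebesgue Q + (\<Sum>j. ennreal (?A * q ^ Suc j) * ennreal (K' * (1 / 2) ^ j * s ^ ?n))"
        by (intro add_left_mono suminf_le mult_left_mono S_le) auto
      also have "(\<Sum>j. ennreal (?A * q ^ Suc j) * ennreal (K' * (1 / 2) ^ j * s ^ ?n)) =
          (\<Sum>j. ennreal (?A * q ^ Suc j * (K' * (1 / 2) ^ j * s ^ ?n)))"
        using q s \<open>0 < K'\<close> by (simp only: ennreal_mult[symmetric] mult_nonneg_nonneg zero_le_power powr_ge_zero less_imp_le)
      also have "\<dots> = ennreal (?A * (K' * q * (1 / (1 - q / 2))) * s ^ ?n)"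
        using q s \<open>0 < K'\<close> by (intro suminf_ennreal_eq[OF _ q_sums]) simp
      also have "ennreal ?A * emeasure lebesgue Q + \<dots> = ennreal (?A * B * s ^ ?n)"
        using s q \<open>0 < K'\<close>
        by (simp add: emeasure_cube B_def ring_distribs ennreal_plus flip: ennreal_mult)
      also have "\<dots> = ennreal C * epow (maximal f x) \<delta> * emeasure lebesgue Q"
        using s m \<delta>0 B
        by (simp add: emeasure_cube epow_ennreal C_def T_def powr_mult mult_ac flip: ennreal_mult)
      finally show ?thesis .
    qed
  qed
qed


subsection \<open>Weight classes\<close>

text \<open>The A_1 condition taken cube by cube: the exceptional null set may depend on Q.\<close>

definition A1_weight :: "real \<Rightarrow> (real ^ 'n \<Rightarrow> real) \<Rightarrow> bool" where
  "A1_weight C w \<longleftrightarrow> w \<in> borel_measurable lebesgue \<and> (\<forall>x. 0 \<le> w x) \<and> (AE x in lebesgue. 0 < w x) \<and>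
     (\<forall>Q\<in>cubes. AE x in lebesgue. x \<in> Q \<longrightarrow> average Q w \<le> ennreal (C * w x))"

section \<open>Almost everywhere statements and averages on cubes\<close>

lemma cubes_not_AE:
  assumes "Q \<in> cubes"
  shows "\<not> (AE x in lebesgue. x \<notin> Q)"
proof
  assume "AE x in lebesgue. x \<notin> Q"
  then have "emeasure lebesgue Q = 0"
    using sets_cubes[OF assms] by (simp add: AE_iff_null_sets[symmetric] null_setsD1)
  then show False using emeasure_cubes[OF assms] by simp
qed

lemma AE_cubesE:
  assumes "Q \<in> cubes" "AE x in lebesgue. x \<in> Q \<longrightarrow> P x"
  obtains x where "x \<in> Q" "P x"
proof -
  have "\<exists>x. x \<in> Q \<and> P x"
  proof (rule ccontr)
    assume "\<not> ?thesis"
    then have "AE x in lebesgue. x \<notin> Q"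
      using assms(2) by (auto elim!: eventually_mono)
    then show False using cubes_not_AE[OF assms(1)] by simp
  qed
  then show ?thesis using that by blast
qed

text \<open>Countably many cubes centred at \<open>x0\<close> exhaust the space. This serves
  \<open>AE_maximal_finite\<close>, where only cubes through a given point can be
  controlled.\<close>

lemma AE_all_cubesI:
  assumes "\<And>Q :: (real ^ 'n) set. Q \<in> cubes \<Longrightarrow> x0 \<in> Q \<Longrightarrow> AE x in lebesgue. x \<in> Q \<longrightarrow> P x"
  shows "AE x in lebesgue. P x"
proof -
  let ?Q = "\<lambda>k::nat. cbox (x0 - vec (Suc k)) (x0 - vec (Suc k) + vec (2 * Suc k))"
  have "AE x in lebesgue. x \<in> ?Q k \<longrightarrow> P x" for k
    by (rule assms) (auto intro!: cubesI simp: mem_cube)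
  then have "AE x in lebesgue. \<forall>k. x \<in> ?Q k \<longrightarrow> P x"
    unfolding AE_all_countable by blast
  then show ?thesis
  proof eventually_elim
    case (elim x)
    obtain k :: nat where k: "norm (x - x0) \<le> k"
      using real_arch_simple by blast
    have "\<bar>x $ i - x0 $ i\<bar> \<le> 1 + real k" for i
      using component_le_norm_cart[of "x - x0" i] k by simp
    then have "x \<in> ?Q k"
      unfolding mem_cube by (simp add: abs_le_iff algebra_simps)
    then show ?case using elim by blast
  qed
qed

lemma average_le_cmult:
  assumes Q: "Q \<in> cubes" and [measurable]: "g \<in> borel_measurable lebesgue" and c: "0 \<le> c"
    and le: "AE x in lebesgue. x \<in> Q \<longrightarrow> \<bar>f x\<bar> \<le> c * \<bar>g x\<bar>"
  shows "average Q f \<le> ennreal c * average Q g"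
proof (rule average_le[OF Q])
  note [measurable] = sets_cubes[OF Q]
  have "(\<integral>\<^sup>+x\<in>Q. ennreal \<bar>f x\<bar> \<partial>lebesgue) \<le> (\<integral>\<^sup>+x. ennreal c * (ennreal \<bar>g x\<bar> * indicator Q x) \<partial>lebesgue)"
    by (rule nn_integral_mono_AE, use le in eventually_elim)
      (use c in \<open>auto simp: indicator_def ennreal_leI simp flip: ennreal_mult\<close>)
  also have "\<dots> = ennreal c * (average Q g * emeasure lebesgue Q)"
    by (simp add: nn_integral_cmult nn_integral_eq_average[OF Q])
  finally show "(\<integral>\<^sup>+x\<in>Q. ennreal \<bar>f x\<bar> \<partial>lebesgue) \<le> ennreal c * average Q g * emeasure lebesgue Q"
    by (simp add: mult.assoc)
qed

lemma average_nonzero: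
  assumes Q: "Q \<in> cubes" and [measurable]: "w \<in> borel_measurable lebesgue"
    and pos: "AE x in lebesgue. 0 < w x"
  shows "average Q w \<noteq> 0"
proof
  note [measurable] = sets_cubes[OF Q]
  assume "average Q w = 0"
  then have "(\<integral>\<^sup>+x\<in>Q. ennreal \<bar>w x\<bar> \<partial>lebesgue) = 0"
    by (simp add: nn_integral_eq_average[OF Q])
  then have "AE x in lebesgue. ennreal \<bar>w x\<bar> * indicator Q x = 0"
    by (subst (asm) nn_integral_0_iff_AE) auto
  with pos have "AE x in lebesgue. x \<notin> Q"
    by eventually_elim (auto simp: indicator_def split: if_splits)
  then show False using cubes_not_AE[OF Q] by simp
qed

text \<open>Evaluating the A_1 inequality at a single good point of Q bounds the average by the real
  number C * w x.\<close>

lemma A1_weight_average: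
  assumes "A1_weight C w" and Q: "Q \<in> cubes"
  obtains a where "0 < a" "average Q w = ennreal a"
proof -
  have "AE x in lebesgue. x \<in> Q \<longrightarrow> average Q w \<le> ennreal (C * w x)"
    using assms by (auto simp: A1_weight_def)
  then obtain x where "average Q w \<le> ennreal (C * w x)"
    by (rule AE_cubesE[OF Q]) (rule that)
  also have "\<dots> < \<infinity>" by simp
  finally have "average Q w < \<infinity>" .
  moreover have "average Q w \<noteq> 0"
    using assms by (intro average_nonzero) (auto simp: A1_weight_def)
  ultimately show ?thesis
  proof (cases "average Q w")
    case (real a)
    then have "0 < a"
      using \<open>average Q w \<noteq> 0\<close> by (cases "a = 0") auto
    then show ?thesis using real that by blast
  qed simp
qed

section \<open>From A_1 weights to A_p and A_\<infinity>\<close>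

lemma locally_integrableI:
  fixes w :: "real ^ 'n \<Rightarrow> real"
  assumes w[measurable]: "w \<in> borel_measurable lebesgue" and fin: "\<And>Q. Q \<in> cubes \<Longrightarrow> average Q w < \<infinity>"
  shows "locally_integrable w"
  unfolding locally_integrable_def
proof (intro conjI allI impI w)
  fix K :: "(real ^ 'n) set" assume K: "compact K"
  then have K_sets[measurable]: "K \<in> sets lebesgue"
    by (simp add: compact_imp_closed)
  obtain b where b: "0 < b" "\<And>x. x \<in> K \<Longrightarrow> norm x \<le> b"
    using compact_imp_bounded[OF K] by (auto simp: bounded_pos)
  let ?Q = "cbox (- vec b) (- vec b + vec (2 * b)) :: (real ^ 'n) set"
  have Q: "?Q \<in> cubes" using b by (intro cubesI) simp
  have "K \<subseteq> ?Q"
  proof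
    fix x assume "x \<in> K"
    then have "\<bar>x $ i\<bar> \<le> b" for i
      using component_le_norm_cart[of x i] b(2)[of x] by linarith
    then show "x \<in> ?Q"
      unfolding mem_cube by (simp add: abs_le_iff) (smt (verit))
  qed
  then have "(\<integral>\<^sup>+x\<in>K. ennreal \<bar>w x\<bar> \<partial>lebesgue) \<le> (\<integral>\<^sup>+x\<in>?Q. ennreal \<bar>w x\<bar> \<partial>lebesgue)"
    by (intro nn_set_integral_set_mono) auto
  also have "\<dots> < \<infinity>"
    unfolding nn_integral_eq_average[OF Q] using fin[OF Q] emeasure_cubes[OF Q]
    by (simp add: ennreal_mult_less_top top.not_eq_extremum)
  finally have "(\<integral>\<^sup>+x\<in>K. ennreal \<bar>w x\<bar> \<partial>lebesgue) < \<infinity>" .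
  also have "(\<integral>\<^sup>+x\<in>K. ennreal \<bar>w x\<bar> \<partial>lebesgue) = (\<integral>\<^sup>+x. ennreal (norm (indicator K x *\<^sub>R w x)) \<partial>lebesgue)"
    by (intro nn_integral_cong) (auto simp: indicator_def)
  finally show "set_integrable lebesgue K w"
    unfolding set_integrable_def by (intro integrableI_bounded) auto
qed

text \<open>The easy direction of the Jones factorization. On Q each A_1 weight is bounded below by
  its average divided by its constant, and this is used where the weight has a negative power:
  \<open>w2\<close> in w, and \<open>w1\<close> in the dual weight.\<close>

lemma Ap_factorization:
  assumes w1: "A1_weight C1 w1" "0 < C1" and w2: "A1_weight C2 w2" "0 < C2" and p: "1 < p"
  defines "w \<equiv> \<lambda>x. w1 x * w2 x powr (1 - p)"
  shows "w \<in> Ap p" "Ap_const p w \<le> ennreal (C1 * C2 powr (p - 1))"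
proof -
  have meas[measurable]: "w1 \<in> borel_measurable lebesgue" "w2 \<in> borel_measurable lebesgue"
    and nonneg: "\<And>x. 0 \<le> w1 x" "\<And>x. 0 \<le> w2 x"
    and pos: "AE x in lebesgue. 0 < w1 x" "AE x in lebesgue. 0 < w2 x"
    using w1 w2 by (auto simp: A1_weight_def)
  have w_meas: "w \<in> borel_measurable lebesgue"
    unfolding w_def by measurable
  let ?v = "\<lambda>x. w x powr (- 1 / (p - 1))"
  have ex: "\<exists>a1 a2. 0 < a1 \<and> 0 < a2 \<and> average Q w \<le> ennreal ((a2 / C2) powr (1 - p) * a1) \<and>
      average Q ?v \<le> ennreal ((a1 / C1) powr (- 1 / (p - 1)) * a2)" if Q: "Q \<in> cubes" for Q
  proof -
    obtain a1 where a1: "0 < a1" "average Q w1 = ennreal a1"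
      using A1_weight_average[OF w1(1) Q] .
    obtain a2 where a2: "0 < a2" "average Q w2 = ennreal a2"
      using A1_weight_average[OF w2(1) Q] .
    have "AE x in lebesgue. x \<in> Q \<longrightarrow> average Q w1 \<le> ennreal (C1 * w1 x)"
      "AE x in lebesgue. x \<in> Q \<longrightarrow> average Q w2 \<le> ennreal (C2 * w2 x)"
      using w1 w2 Q by (auto simp: A1_weight_def)
    then have low: "AE x in lebesgue. x \<in> Q \<longrightarrow> a1 / C1 \<le> w1 x \<and> a2 / C2 \<le> w2 x"
      by eventually_elim (use a1 a2 w1 w2 nonneg in \<open>auto simp: field_simps ennreal_le_iff\<close>)
    have "average Q w \<le> ennreal ((a2 / C2) powr (1 - p)) * average Q w1"
    proof (rule average_le_cmult[OF Q])
      show "AE x in lebesgue. x \<in> Q \<longrightarrow> \<bar>w x\<bar> \<le> (a2 / C2) powr (1 - p) * \<bar>w1 x\<bar>"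
        using low
      proof (eventually_elim, intro impI)
        fix x assume "x \<in> Q \<longrightarrow> a1 / C1 \<le> w1 x \<and> a2 / C2 \<le> w2 x" "x \<in> Q"
        then have "w2 x powr (1 - p) \<le> (a2 / C2) powr (1 - p)"
          using a2 w2 p by (intro powr_mono2') auto
        then show "\<bar>w x\<bar> \<le> (a2 / C2) powr (1 - p) * \<bar>w1 x\<bar>"
          using nonneg by (simp add: w_def abs_mult mult.commute mult_left_mono)
      qed
    qed auto
    moreover have "average Q ?v \<le> ennreal ((a1 / C1) powr (- 1 / (p - 1))) * average Q w2"
    proof (rule average_le_cmult[OF Q])
      show "AE x in lebesgue. x \<in> Q \<longrightarrow> \<bar>?v x\<bar> \<le> (a1 / C1) powr (- 1 / (p - 1)) * \<bar>w2 x\<bar>"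
        using low pos(2)
      proof (eventually_elim, intro impI)
        fix x assume "x \<in> Q \<longrightarrow> a1 / C1 \<le> w1 x \<and> a2 / C2 \<le> w2 x" "x \<in> Q" "0 < w2 x"
        then have le: "w1 x powr (- 1 / (p - 1)) \<le> (a1 / C1) powr (- 1 / (p - 1))"
          using a1 w1 p by (intro powr_mono2') auto
        \<comment> \<open>Passing to the dual weight restores \<open>w2\<close> to the first power,
          so its average over Q appears.\<close>
        have "(1 - p) * (- 1 / (p - 1)) = 1" using p by (simp add: field_simps)
        then have "?v x = w1 x powr (- 1 / (p - 1)) * w2 x"
          using nonneg \<open>0 < w2 x\<close> by (simp add: w_def powr_mult powr_powr)
        then show "\<bar>?v x\<bar> \<le> (a1 / C1) powr (- 1 / (p - 1)) * \<bar>w2 x\<bar>"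
          using le nonneg by (simp add: mult_right_mono)
      qed
    qed auto
    ultimately show ?thesis
      using a1 a2 by (intro exI[of _ a1] exI[of _ a2]) (simp add: ennreal_mult)
  qed
  show const: "Ap_const p w \<le> ennreal (C1 * C2 powr (p - 1))"
    unfolding Ap_const_def
  proof (rule SUP_least)
    fix Q :: "(real ^ 'a) set" assume "Q \<in> cubes"
    then obtain a1 a2 where a: "0 < a1" "0 < a2" "average Q w \<le> ennreal ((a2 / C2) powr (1 - p) * a1)"
      "average Q ?v \<le> ennreal ((a1 / C1) powr (- 1 / (p - 1)) * a2)"
      using ex by blast
    have "average Q w * epow (average Q ?v) (p - 1) \<le>
        ennreal ((a2 / C2) powr (1 - p) * a1) * epow (ennreal ((a1 / C1) powr (- 1 / (p - 1)) * a2)) (p - 1)"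
      using a p by (intro mult_mono epow_mono) auto
    also have "\<dots> = ennreal (((a2 / C2) powr (1 - p) * a1) * ((a1 / C1) powr (- 1 / (p - 1)) * a2) powr (p - 1))"
      using a p by (subst epow_ennreal) (simp_all flip: ennreal_mult)
    \<comment> \<open>The averages \<open>a1\<close> and \<open>a2\<close> cancel, so the bound is
      the same for all cubes.\<close>
    also have "((a2 / C2) powr (1 - p) * a1) * ((a1 / C1) powr (- 1 / (p - 1)) * a2) powr (p - 1) = C1 * C2 powr (p - 1)"
    proof -
      have "(- 1 / (p - 1)) * (p - 1) = - 1" using p by simp
      then have "((a1 / C1) powr (- 1 / (p - 1)) * a2) powr (p - 1) = (a1 / C1) powr (- 1) * a2 powr (p - 1)"
        using a by (simp only: powr_mult powr_powr)
      also have "(a1 / C1) powr (- 1) = C1 / a1"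
        using a w1 by (simp add: powr_minus)
      finally have 1: "((a1 / C1) powr (- 1 / (p - 1)) * a2) powr (p - 1) = C1 / a1 * a2 powr (p - 1)" .
      have "1 - p = - (p - 1)" by simp
      then have "(a2 / C2) powr (1 - p) = C2 powr (p - 1) / a2 powr (p - 1)"
        using a w2 by (simp only: powr_minus powr_divide less_imp_le inverse_divide)
      then show ?thesis
        using a unfolding 1 by simp
    qed
    finally show "average Q w * epow (average Q ?v) (p - 1) \<le> ennreal (C1 * C2 powr (p - 1))" .
  qed
  have "locally_integrable w"
  proof (rule locally_integrableI[OF w_meas])
    fix Q :: "(real ^ 'a) set" assume "Q \<in> cubes"
    then show "average Q w < \<infinity>"
      using ex by (metis ennreal_less_top infinity_ennreal_def order_le_less_trans)
  qed
  moreover have "AE x in lebesgue. 0 < w x"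
    using pos by eventually_elim (simp add: w_def)
  ultimately have "weight w"
    using nonneg by (simp add: weight_def w_def)
  then show "w \<in> Ap p"
    using const by (auto simp: Ap_def intro: order_le_less_trans)
qed

text \<open>Leads from averages in \<open>ennreal\<close> to Bochner integrals, in which the
  logarithms below, having no fixed sign, are integrated.\<close>

lemma integral_eq_average:
  assumes Q: "Q \<in> cubes" and [measurable]: "v \<in> borel_measurable lebesgue" and "\<And>x. 0 \<le> v x"
    and b: "average Q v = ennreal b" "0 \<le> b"
  shows "set_integrable lebesgue Q v" "(LINT x:Q|lebesgue. v x) = b * measure lebesgue Q"
proof -
  note [measurable] = sets_cubes[OF Q]
  have eq: "(\<integral>\<^sup>+x. ennreal (indicator Q x *\<^sub>R v x) \<partial>lebesgue) = ennreal (b * measure lebesgue Q)"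
  proof -
    have "(\<integral>\<^sup>+x. ennreal (indicator Q x *\<^sub>R v x) \<partial>lebesgue) = (\<integral>\<^sup>+x\<in>Q. ennreal \<bar>v x\<bar> \<partial>lebesgue)"
      using assms by (intro nn_integral_cong) (auto simp: indicator_def)
    also have "\<dots> = ennreal b * emeasure lebesgue Q"
      using nn_integral_eq_average[OF Q, of v] b by simp
    also have "\<dots> = ennreal (b * measure lebesgue Q)"
      using b emeasure_cubes[OF Q] by (simp add: emeasure_eq_ennreal_measure ennreal_mult)
    finally show ?thesis .
  qed
  show "set_integrable lebesgue Q v"
    unfolding set_integrable_def
    using assms eq by (intro integrableI_nn_integral_finite[where x="b * measure lebesgue Q"]) auto
  show "(LINT x:Q|lebesgue. v x) = b * measure lebesgue Q"
    unfolding set_lebesgue_integral_def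
    using assms eq by (subst integral_eq_nn_integral) auto
qed

text \<open>Jensen's inequality for the logarithm of the dual weight v, since ln (1 / w) = (p - 1) *
  ln v. Positivity is recorded as well, because a locally bounded function is controlled only on
  intervals (0, K).\<close>

lemma Ainfty_const_le_Ap_const:
  assumes w: "w \<in> Ap p" and p: "1 < p"
  shows "0 < Ainfty_const w" "ennreal (Ainfty_const w) \<le> Ap_const p w"
proof -
  have loc: "locally_integrable w" and nonneg: "\<And>x. 0 \<le> w x" and pos: "AE x in lebesgue. 0 < w x"
    and fin: "Ap_const p w < \<infinity>"
    using w by (auto simp: Ap_def weight_def)
  have [measurable]: "w \<in> borel_measurable lebesgue"
    using loc by (simp add: locally_integrable_def)
  let ?v = "\<lambda>x. w x powr (- 1 / (p - 1))"
  let ?L = "\<lambda>Q. (LINT x:Q|lebesgue. ln (inverse (w x))) / measure lebesgue Q"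
  let ?S = "SUP Q\<in>cubes. average Q w * ennreal (exp (?L Q))"
  have le: "average Q w * ennreal (exp (?L Q)) \<le> Ap_const p w" if Q: "Q \<in> cubes" for Q
  proof -
    note [measurable] = sets_cubes[OF Q]
    have m: "0 < measure lebesgue Q"
      using emeasure_cubes[OF Q] by (simp add: measure_def enn2real_positive_iff top.not_eq_extremum zero_less_iff_neq_zero)
    have Ap_le: "average Q w * epow (average Q ?v) (p - 1) \<le> Ap_const p w"
      unfolding Ap_const_def using Q by (intro SUP_upper)
    have w0: "average Q w \<noteq> 0"
      using Q pos by (intro average_nonzero) auto
    have v0: "average Q ?v \<noteq> 0"
      using Q pos by (intro average_nonzero) auto
    \<comment> \<open>The average of w is nonzero, so an infinite dual average would make the A_p
      constant infinite.\<close>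
    have "average Q ?v \<noteq> \<infinity>"
      using Ap_le fin w0 p by (auto simp: epow_def ennreal_mult_top top_unique)
    then obtain b where b: "average Q ?v = ennreal b" "0 < b"
      using v0 by (cases "average Q ?v") (auto simp: less_le)
    note v_int = integral_eq_average[OF Q _ _ b(1), simplified, OF less_imp_le[OF b(2)]]
    have "compact Q" using Q by (auto elim!: cubesE)
    then have w_int: "set_integrable lebesgue Q w"
      using loc by (simp add: locally_integrable_def)
    have ln_v: "AE x in lebesgue. ln (inverse (w x)) = (p - 1) * ln (?v x)"
      using pos by eventually_elim (use p in \<open>simp add: ln_powr ln_inverse\<close>)
    \<comment> \<open>Integrability, so that the Bochner integral has no default value: ln w \<le> w
      bounds one sign, and - ln w = (p - 1) * ln v \<le> (p - 1) * v the other.\<close>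
    have ln_int: "set_integrable lebesgue Q (\<lambda>x. ln (inverse (w x)))"
    proof (rule set_integrable_bound)
      show "set_integrable lebesgue Q (\<lambda>x. w x + (p - 1) * ?v x)"
        using w_int v_int by (intro set_integral_add set_integrable_mult_right) auto
      show "set_borel_measurable lebesgue Q (\<lambda>x. ln (inverse (w x)))"
        unfolding set_borel_measurable_def by measurable
      show "AE x in lebesgue. x \<in> Q \<longrightarrow> norm (ln (inverse (w x))) \<le> norm (w x + (p - 1) * ?v x)"
        using pos ln_v
      proof (eventually_elim, intro impI)
        fix x assume x: "0 < w x" "ln (inverse (w x)) = (p - 1) * ln (?v x)"
        have 1: "ln (w x) \<le> w x" using x ln_bound by simp
        have "ln (?v x) \<le> ?v x" using x by (intro ln_bound) simp
        then have 2: "(p - 1) * ln (?v x) \<le> (p - 1) * ?v x" using p by (intro mult_left_mono) auto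
        have 3: "0 \<le> (p - 1) * ?v x" using p by simp
        have 4: "ln (inverse (w x)) = - ln (w x)" using x by (simp add: ln_inverse)
        show "norm (ln (inverse (w x))) \<le> norm (w x + (p - 1) * ?v x)"
          using 1 2 3 4 x by simp
      qed
    qed
    \<comment> \<open>Jensen's inequality through the tangent line of ln at b: ln v \<le> ln b - 1 +
      v / b. As b is the average of v, the terms -1 and v / b cancel after integration.\<close>
    have "(LINT x:Q|lebesgue. ln (inverse (w x))) \<le> (LINT x:Q|lebesgue. (p - 1) * (ln b - 1) + (p - 1) / b * ?v x)"
    proof (rule set_integral_mono_AE[OF ln_int])
      show "set_integrable lebesgue Q (\<lambda>x. (p - 1) * (ln b - 1) + (p - 1) / b * ?v x)"
        using v_int emeasure_cubes[OF Q]
        by (intro set_integral_add set_integrable_mult_right) (auto simp: set_integrable_def top.not_eq_extremum)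
      show "AE x\<in>Q in lebesgue. ln (inverse (w x)) \<le> (p - 1) * (ln b - 1) + (p - 1) / b * ?v x"
        using pos ln_v
      proof (eventually_elim, intro impI)
        fix x assume x: "0 < w x" "ln (inverse (w x)) = (p - 1) * ln (?v x)"
        have "ln (?v x / b) \<le> ?v x / b - 1"
          using x b by (intro ln_le_minus_one) simp
        then have "ln (?v x) \<le> ln b - 1 + ?v x / b"
          using x b by (simp add: ln_div)
        then have "(p - 1) * ln (?v x) \<le> (p - 1) * (ln b - 1 + ?v x / b)"
          using p by (intro mult_left_mono) auto
        then show "ln (inverse (w x)) \<le> (p - 1) * (ln b - 1) + (p - 1) / b * ?v x"
          using x by (simp add: distrib_left)
      qed
    qed
    also have "\<dots> = (LINT x:Q|lebesgue. (p - 1) * (ln b - 1)) + (LINT x:Q|lebesgue. (p - 1) / b * ?v x)"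
      using v_int emeasure_cubes[OF Q]
      by (intro set_integral_add set_integrable_mult_right) (auto simp: set_integrable_def top.not_eq_extremum)
    also have "\<dots> = (p - 1) * ln b * measure lebesgue Q"
    proof -
      have "(LINT x:Q|lebesgue. (p - 1) * (ln b - 1)) = (p - 1) * (ln b - 1) * measure lebesgue Q"
        using emeasure_cubes[OF Q] by (simp add: set_integral_const top.not_eq_extremum)
      moreover have "(LINT x:Q|lebesgue. (p - 1) / b * ?v x) = (p - 1) / b * (b * measure lebesgue Q)"
        by (subst set_integral_mult_right) (use v_int(2) in simp)
      moreover have "(p - 1) * (ln b - 1) * M + (p - 1) / b * (b * M) = (p - 1) * ln b * M" for M
        using b by (simp add: field_simps)
      ultimately show ?thesis by (simp only:)
    qed
    finally have "?L Q \<le> (p - 1) * ln b"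
      using m by (simp add: field_simps)
    then have "exp (?L Q) \<le> b powr (p - 1)"
      using b by (simp add: powr_def)
    then have "ennreal (exp (?L Q)) \<le> epow (average Q ?v) (p - 1)"
      using b p by (simp add: epow_ennreal ennreal_leI)
    then have "average Q w * ennreal (exp (?L Q)) \<le> average Q w * epow (average Q ?v) (p - 1)"
      by (intro mult_left_mono) auto
    then show ?thesis using Ap_le by (rule order_trans)
  qed
  then have S_le: "?S \<le> Ap_const p w"
    by (intro SUP_least)
  then have S_fin: "?S < \<infinity>" using fin by (rule order_le_less_trans)
  have "cbox 0 (0 + vec 1) \<in> (cubes :: (real ^ 'a) set set)"
    by (intro cubesI) simp
  then obtain Q0 :: "(real ^ 'a) set" where Q0: "Q0 \<in> cubes" by blast
  have "0 < average Q0 w * ennreal (exp (?L Q0))"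
    using average_nonzero[OF Q0 _ pos] by (simp add: ennreal_zero_less_mult_iff zero_less_iff_neq_zero)
  also have "\<dots> \<le> ?S"
    using Q0 by (intro SUP_upper)
  finally have "0 < ?S" .
  then show "0 < Ainfty_const w"
    unfolding Ainfty_const_def using S_fin by (simp add: enn2real_positive_iff)
  show "ennreal (Ainfty_const w) \<le> Ap_const p w"
    unfolding Ainfty_const_def using S_le S_fin by simp
qed

text \<open>By the A_1 bound for the exponent 1/2, the square root of M f is integrable over every
  cube through \<open>x0\<close>; any exponent in (0, 1) would do.\<close>

lemma AE_maximal_finite:
  fixes f :: "real ^ 'n \<Rightarrow> real"
  assumes [measurable]: "f \<in> borel_measurable lebesgue" and x0: "maximal f x0 < \<infinity>"
  shows "AE x in lebesgue. maximal f x < \<infinity>"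
proof (rule AE_all_cubesI)
  fix Q assume Q: "Q \<in> cubes" "x0 \<in> Q"
  note [measurable] = sets_cubes[OF Q(1)]
  obtain C where C: "1 \<le> C"
    "\<And>(f :: real ^ 'n \<Rightarrow> real) Q x. f \<in> borel_measurable lebesgue \<Longrightarrow> Q \<in> cubes \<Longrightarrow> x \<in> Q \<Longrightarrow>
      (\<integral>\<^sup>+z\<in>Q. epow (maximal f z) (1 / 2) \<partial>lebesgue) \<le> ennreal C * epow (maximal f x) (1 / 2) * emeasure lebesgue Q"
    using maximal_powr_A1[of "1 / 2"] by auto
  have "(\<integral>\<^sup>+z\<in>Q. epow (maximal f z) (1 / 2) \<partial>lebesgue) \<le> ennreal C * epow (maximal f x0) (1 / 2) * emeasure lebesgue Q"
    using Q by (intro C(2)) auto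
  also have "\<dots> < \<infinity>"
    using x0 emeasure_cubes[OF Q(1)]
    by (auto simp: ennreal_mult_less_top epow_def top.not_eq_extremum)
  finally have "AE z in lebesgue. epow (maximal f z) (1 / 2) * indicator Q z \<noteq> \<infinity>"
    by (intro nn_integral_PInf_AE) auto
  then show "AE x in lebesgue. x \<in> Q \<longrightarrow> maximal f x < \<infinity>"
    by eventually_elim (auto simp: epow_def top.not_eq_extremum split: if_splits)
qed

text \<open>Passes from the power of M f with values in [0, \<infinity>] to a real-valued weight.
  The two can differ only where M f = \<infinity>, a null set, and M f vanishes nowhere once it is
  nonzero at \<open>x0\<close>.\<close>

lemma A1_weight_maximal_powr:
  fixes f :: "real ^ 'n \<Rightarrow> real"
  assumes [measurable]: "f \<in> borel_measurable lebesgue"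
    and x0: "maximal f x0 < \<infinity>" "maximal f x0 \<noteq> 0" and \<delta>: "0 \<le> \<delta>"
    and C: "\<And>Q x. Q \<in> cubes \<Longrightarrow> x \<in> Q \<Longrightarrow>
      (\<integral>\<^sup>+z\<in>Q. epow (maximal f z) \<delta> \<partial>lebesgue) \<le> ennreal C * epow (maximal f x) \<delta> * emeasure lebesgue Q"
  shows "A1_weight C (\<lambda>x. enn2real (maximal f x) powr \<delta>)"
proof -
  have fin: "AE x in lebesgue. maximal f x < \<infinity>"
    using x0(1) by (rule AE_maximal_finite[rotated]) simp
  have nz: "maximal f x \<noteq> 0" for x
    using x0(2) maximal_eq_0 by blast
  have pos: "0 < enn2real (maximal f x)" if "maximal f x < \<infinity>" for x
    using that nz[of x] by (simp add: enn2real_positive_iff zero_less_iff_neq_zero)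
  have eq: "epow (maximal f x) \<delta> = ennreal (enn2real (maximal f x) powr \<delta>)" if "maximal f x < \<infinity>" for x
    using that pos[OF that] by (auto simp: epow_def)
  show ?thesis
    unfolding A1_weight_def
  proof (intro conjI ballI allI)
    show "AE x in lebesgue. 0 < enn2real (maximal f x) powr \<delta>"
      using fin by eventually_elim (use pos in force)
  next
    fix Q :: "(real ^ 'n) set" assume Q: "Q \<in> cubes"
    show "AE x in lebesgue. x \<in> Q \<longrightarrow>
      average Q (\<lambda>x. enn2real (maximal f x) powr \<delta>) \<le> ennreal (C * enn2real (maximal f x) powr \<delta>)"
      using fin
    proof (eventually_elim, intro impI)
      fix x assume x: "maximal f x < \<infinity>" "x \<in> Q"
      have "(\<integral>\<^sup>+z\<in>Q. ennreal \<bar>enn2real (maximal f z) powr \<delta>\<bar> \<partial>lebesgue) = (\<integral>\<^sup>+z\<in>Q. epow (maximal f z) \<delta> \<partial>lebesgue)"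
        by (rule nn_integral_cong_AE, use fin in eventually_elim) (simp add: eq)
      also have "\<dots> \<le> ennreal (C * enn2real (maximal f x) powr \<delta>) * emeasure lebesgue Q"
        using C[OF Q x(2)] eq[OF x(1)] by (simp add: ennreal_mult'')
      finally show "average Q (\<lambda>x. enn2real (maximal f x) powr \<delta>) \<le> ennreal (C * enn2real (maximal f x) powr \<delta>)"
        by (rule average_le[OF Q])
    qed
  qed auto
qed


subsection \<open>The extrapolation estimate\<close>

lemma epow_cmult:
  assumes "0 < a" "0 < p"
  shows "epow (ennreal a * x) p = ennreal (a powr p) * epow x p"
proof (cases x)
  case (real b)
  then show ?thesis
    using assms by (simp add: epow_ennreal powr_mult flip: ennreal_mult)
next
  case top
  then show ?thesis
    using assms by (simp add: ennreal_mult_top epow_def)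
qed

lemma epow_epow_inverse: "0 < p \<Longrightarrow> epow (epow x (1 / p)) p = x"
  by (cases x) (auto simp: epow_ennreal powr_powr epow_def)

text \<open>Only the level y of the supremum in the weak norm is kept; raising to the power p and
  dividing by y powr p isolates the distribution function.\<close>

lemma distrib_fun_le_of_weak_Lp_norm:
  assumes p: "0 < p" and B: "0 < B" and y: "0 < y"
    and le: "weak_Lp_norm p w g \<le> ennreal B * Lp_norm p w f"
  shows "distrib_fun w (\<lambda>x. ennreal \<bar>g x\<bar>) y \<le>
    ennreal (B powr p / y powr p) * (\<integral>\<^sup>+x. epow (ennreal \<bar>f x\<bar>) p * ennreal (w x) \<partial>lebesgue)"
    (is "?D \<le> _ * ?I")
proof -
  have "ennreal y * epow ?D (1 / p) \<le> weak_Lp_norm p w g"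
    unfolding weak_Lp_norm_def using y by (intro SUP_upper) simp
  also note le
  finally have "epow (ennreal y * epow ?D (1 / p)) p \<le> epow (ennreal B * epow ?I (1 / p)) p"
    using p by (intro epow_mono) (auto simp: Lp_norm_def)
  then have "ennreal (y powr p) * ?D \<le> ennreal (B powr p) * ?I"
    using p y B by (simp add: epow_cmult epow_epow_inverse)
  then have "ennreal (1 / y powr p) * (ennreal (y powr p) * ?D) \<le> ennreal (1 / y powr p) * (ennreal (B powr p) * ?I)"
    by (rule mult_left_mono) simp
  also have "ennreal (1 / y powr p) * (ennreal (y powr p) * ?D) = ?D"
    using y by (simp add: mult.assoc[symmetric] flip: ennreal_mult)
  also have "ennreal (1 / y powr p) * (ennreal (B powr p) * ?I) = ennreal (B powr p / y powr p) * ?I"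
    by (simp add: mult.assoc[symmetric] flip: ennreal_mult)
  finally show ?thesis .
qed

lemma maximal_le_bound:
  assumes "\<And>x. \<bar>f x\<bar> \<le> c"
  shows "maximal f x \<le> ennreal c"
proof (rule maximal_leI)
  fix Q :: "(real ^ 'a) set" assume Q: "Q \<in> cubes"
  have "(\<integral>\<^sup>+x\<in>Q. ennreal \<bar>f x\<bar> \<partial>lebesgue) \<le> (\<integral>\<^sup>+x\<in>Q. ennreal c \<partial>lebesgue)"
    using assms by (intro nn_integral_mono mult_right_mono ennreal_leI) auto
  also have "\<dots> = ennreal c * emeasure lebesgue Q"
    using sets_cubes[OF Q] by (simp add: nn_integral_cmult_indicator)
  finally show "(\<integral>\<^sup>+x\<in>Q. ennreal \<bar>f x\<bar> \<partial>lebesgue) \<le> ennreal c * emeasure lebesgue Q" .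
qed

lemma AE_eq_0_if_maximal_eq_0:
  assumes "f \<in> borel_measurable lebesgue" "maximal f x0 = 0"
  shows "AE x in lebesgue. f x = 0"
  using AE_le_maximal[OF assms(1)]
  by eventually_elim (use maximal_eq_0[OF assms(2)] in simp)

text \<open>Provides the weight for the degenerate case f = 0, where M_r f vanishes and its negative
  power is no weight.\<close>

lemma one_in_Ap: "(\<lambda>_. 1) \<in> Ap 2"
proof -
  have "A1_weight 1 (\<lambda>_ :: real ^ 'a. 1)"
    unfolding A1_weight_def
  proof (intro conjI ballI)
    fix Q :: "(real ^ 'a) set" assume Q: "Q \<in> cubes"
    have "average Q (\<lambda>_. 1) \<le> 1"
      using sets_cubes[OF Q] by (intro average_le[OF Q]) simp
    then show "AE x in lebesgue. x \<in> Q \<longrightarrow> average Q (\<lambda>_. 1) \<le> ennreal (1 * 1)"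
      by simp
  qed auto
  then show ?thesis
    using Ap_factorization(1)[of 1 "\<lambda>_. 1" 1 "\<lambda>_. 1" 2] by simp
qed

lemma maximal_pow_mono:
  assumes "0 < \<mu>" "\<And>x. \<bar>f x\<bar> \<le> \<bar>g x\<bar>"
  shows "maximal_pow \<mu> f x \<le> maximal_pow \<mu> g x"
  unfolding maximal_pow_def
  using assms by (intro epow_mono maximal_mono) (auto intro!: powr_mono2)

lemma measurable_maximal_pow [measurable]: "maximal_pow \<mu> f \<in> borel_measurable lebesgue"
  unfolding maximal_pow_def by measurable

lemma maximal_pow_eq:
  assumes "maximal (\<lambda>z. \<bar>f z\<bar> powr (1 / \<mu>)) x < \<infinity>" "0 < \<mu>"
  shows "maximal_pow \<mu> f x = ennreal (enn2real (maximal (\<lambda>z. \<bar>f z\<bar> powr (1 / \<mu>)) x) powr \<mu>)"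
  using assms by (auto simp: maximal_pow_def epow_def)

text \<open>\<open>G\<close> and \<open>H\<close> are the functions with \<open>M\<^sub>r f = (M G) powr r\<close> and \<open>M\<^sub>\<mu> h = (M H) powr \<mu>\<close>; the
  condition on \<open>\<delta>\<close> makes \<open>(M\<^sub>r f) powr (- \<alpha>)\<close> the \<open>1 - p\<close> power of the \<open>A\<^sub>1\<close> weight \<open>(M G) powr \<delta>\<close>.\<close>

lemma bounded_function_estimate:
  fixes f g h :: "real ^ 'n \<Rightarrow> real" and p\<^sub>0 \<alpha> \<mu> r \<delta> p :: real
  defines "G \<equiv> \<lambda>z. \<bar>f z\<bar> powr (1 / r)" and "H \<equiv> \<lambda>z. \<bar>h z\<bar> powr (1 / \<mu>)"
  assumes par: "1 \<le> p\<^sub>0" "0 \<le> \<alpha>" "\<alpha> \<le> p\<^sub>0" "0 < \<mu>" "\<mu> < 1" "0 < r"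
    and f[measurable]: "f \<in> borel_measurable lebesgue" "\<And>x. 0 \<le> f x"
    and g[measurable]: "g \<in> borel_measurable lebesgue" "\<And>x. 0 \<le> g x"
    and h[measurable]: "h \<in> borel_measurable lebesgue" "\<And>x. 0 \<le> h x" "\<And>x. h x \<le> N"
      "\<And>x. g x \<le> y \<Longrightarrow> h x = 0"
    and y: "0 < y" and B: "0 < B" and p: "1 < p" and \<delta>: "0 \<le> \<delta>" "\<delta> * (p - 1) = r * \<alpha>"
    and x0: "maximal G x0 < \<infinity>" "maximal G x0 \<noteq> 0"
    and C1: "1 \<le> C1" "\<And>Q x. Q \<in> cubes \<Longrightarrow> x \<in> Q \<Longrightarrow>
      (\<integral>\<^sup>+z\<in>Q. epow (maximal H z) \<mu> \<partial>lebesgue) \<le> ennreal C1 * epow (maximal H x) \<mu> * emeasure lebesgue Q"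
    and C2: "1 \<le> C2" "\<And>Q x. Q \<in> cubes \<Longrightarrow> x \<in> Q \<Longrightarrow>
      (\<integral>\<^sup>+z\<in>Q. epow (maximal G z) \<delta> \<partial>lebesgue) \<le> ennreal C2 * epow (maximal G x) \<delta> * emeasure lebesgue Q"
    and weak: "\<And>w. w \<in> Ap p \<Longrightarrow> Ap_const p w \<le> ennreal (C1 * C2 powr (p - 1)) \<Longrightarrow>
      weak_Lp_norm p\<^sub>0 w g \<le> ennreal B * Lp_norm p\<^sub>0 w f"
  shows "(\<integral>\<^sup>+x. ennreal (h x) \<partial>lebesgue) \<le> distrib_fun h (maximal_pow r f) y +
    ennreal (B powr p\<^sub>0) * (ennreal (1 / y powr (p\<^sub>0 - \<alpha>)) *
      (\<integral>\<^sup>+x. epow (ennreal (f x)) (p\<^sub>0 - \<alpha>) * maximal_pow \<mu> h x \<partial>lebesgue))"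
    (is "_ \<le> ?D + ennreal (B powr p\<^sub>0) * (_ * ?J)")
proof (cases "maximal H x0 = 0")
  \<comment> \<open>Here M H is no weight, but H = 0 almost everywhere, so the left-hand side is
    0.\<close>
  case True
  have "H \<in> borel_measurable lebesgue" unfolding H_def by measurable
  then have "AE x in lebesgue. H x = 0"
    using True by (rule AE_eq_0_if_maximal_eq_0)
  then have "AE x in lebesgue. ennreal (h x) = 0"
    by eventually_elim (simp add: H_def)
  then have "(\<integral>\<^sup>+x. ennreal (h x) \<partial>lebesgue) = 0"
    by (subst nn_integral_0_iff_AE) auto
  then show ?thesis by simp
next
  case False
  have [measurable]: "H \<in> borel_measurable lebesgue" "G \<in> borel_measurable lebesgue"
    unfolding H_def G_def by measurable
  \<comment> \<open>Boundedness of h is used here: it keeps M H finite at every point.\<close>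
  have H_fin: "maximal H x < \<infinity>" for x
  proof -
    have "maximal H x \<le> ennreal (N powr (1 / \<mu>))"
      using par h by (intro maximal_le_bound) (auto simp: H_def intro!: powr_mono2)
    then show ?thesis by (rule order_le_less_trans) simp
  qed
  define m where "m x = enn2real (maximal G x)" for x
  define w1 where "w1 = (\<lambda>x. enn2real (maximal H x) powr \<mu>)"
  define w2 where "w2 = (\<lambda>x. m x powr \<delta>)"
  define w where "w = (\<lambda>x. w1 x * w2 x powr (1 - p))"
  have [measurable]: "w1 \<in> borel_measurable lebesgue" "m \<in> borel_measurable lebesgue" "w \<in> borel_measurable lebesgue"
    unfolding w1_def w_def w2_def m_def by measurable
  have w1: "A1_weight C1 w1"
    unfolding w1_def using H_fin False par C1 by (intro A1_weight_maximal_powr) auto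
  have w2: "A1_weight C2 w2"
    unfolding w2_def m_def using x0 \<delta> C2 by (intro A1_weight_maximal_powr) auto
  have w: "w x = w1 x * m x powr (- (r * \<alpha>))" for x
  proof -
    have "\<delta> * (1 - p) = - (r * \<alpha>)" using \<delta> by (simp add: algebra_simps)
    then show ?thesis by (simp add: w_def w2_def powr_powr)
  qed
  have w1_eq: "maximal_pow \<mu> h x = ennreal (w1 x)" for x
    unfolding w1_def H_def using H_fin par by (intro maximal_pow_eq) (auto simp: H_def)
  have w1_nonneg: "0 \<le> w1 x" for x by (simp add: w1_def)
  have G_pos: "maximal G x \<noteq> 0" for x
    using x0(2) maximal_eq_0 by blast
  have "AE x in lebesgue. maximal G x < \<infinity>"
    using x0(1) by (intro AE_maximal_finite) auto
  \<comment> \<open>The bound f \<le> M_r f comes from G \<le> M G by raising to the power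
    r.\<close>
  then have m: "AE x in lebesgue. 0 < m x \<and> maximal_pow r f x = ennreal (m x powr r) \<and> f x \<le> m x powr r"
    using AE_le_maximal[OF \<open>G \<in> borel_measurable lebesgue\<close>]
  proof eventually_elim
    case (elim x)
    have "0 < m x"
      using elim G_pos[of x] by (simp add: m_def enn2real_positive_iff zero_less_iff_neq_zero)
    moreover have "maximal_pow r f x = ennreal (m x powr r)"
      unfolding m_def G_def using elim par by (intro maximal_pow_eq) (auto simp: G_def)
    moreover have "G x \<le> m x"
      using elim enn2real_mono[of "ennreal \<bar>G x\<bar>" "maximal G x"] by (simp add: m_def)
    then have "G x powr r \<le> m x powr r"
      using par by (intro powr_mono2) (auto simp: G_def)
    then have "f x \<le> m x powr r"
      using par f by (simp add: G_def powr_powr)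
    ultimately show ?case by simp
  qed
  have h_le: "AE x in lebesgue. h x \<le> w1 x"
    using AE_le_maximal[OF \<open>H \<in> borel_measurable lebesgue\<close>]
  proof eventually_elim
    case (elim x)
    have "H x \<le> enn2real (maximal H x)"
      using elim H_fin enn2real_mono[of "ennreal \<bar>H x\<bar>" "maximal H x"] by (simp add: H_def)
    then have "H x powr \<mu> \<le> w1 x"
      unfolding w1_def using par by (intro powr_mono2) (auto simp: H_def)
    then show ?case using par h by (simp add: H_def powr_powr)
  qed
  let ?S = "{x. ennreal y < ennreal \<bar>g x\<bar>}" and ?T = "{x. ennreal y < maximal_pow r f x}"
  have S: "x \<in> ?S \<longleftrightarrow> y < g x" for x
    using y g by (simp add: ennreal_less_iff)
  have S_sets[measurable]: "?S \<in> sets lebesgue" and T_sets[measurable]: "?T \<in> sets lebesgue"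
    by (auto intro!: borel_measurable_less[where M=lebesgue, simplified])
  \<comment> \<open>The set \<open>?T\<close> is charged to h itself. Off \<open>?T\<close>, a
    nonzero h forces g > y, and M_r f \<le> y lets the factor y powr \<alpha> absorb the negative
    power of M_r f in w.\<close>
  have "(\<integral>\<^sup>+x. ennreal (h x) \<partial>lebesgue) \<le>
      (\<integral>\<^sup>+x. ennreal (h x) * indicator ?T x + ennreal (y powr \<alpha>) * (ennreal (w x) * indicator ?S x) \<partial>lebesgue)"
  proof (rule nn_integral_mono_AE, use m h_le in eventually_elim)
    fix x assume mx: "0 < m x \<and> maximal_pow r f x = ennreal (m x powr r) \<and> f x \<le> m x powr r"
      and hx: "h x \<le> w1 x"
    show "ennreal (h x) \<le> ennreal (h x) * indicator ?T x + ennreal (y powr \<alpha>) * (ennreal (w x) * indicator ?S x)"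
    proof (cases "x \<in> ?T \<or> h x = 0")
      case False
      then have "x \<in> ?S" using h(4)[of x] S by force
      have "m x powr r \<le> y"
        using False mx y by (auto simp: ennreal_less_iff not_less)
      then have "y powr (- \<alpha>) \<le> (m x powr r) powr (- \<alpha>)"
        using mx par by (intro powr_mono2') auto
      then have "w1 x * y powr (- \<alpha>) \<le> w x"
        unfolding w using w1_nonneg by (intro mult_left_mono) (auto simp: powr_powr)
      then have "y powr \<alpha> * (w1 x * y powr (- \<alpha>)) \<le> y powr \<alpha> * w x"
        by (intro mult_left_mono) auto
      then have "h x \<le> y powr \<alpha> * w x"
        using hx y by (simp add: powr_minus field_simps)
      then have "ennreal (h x) \<le> ennreal (y powr \<alpha>) * ennreal (w x)"
        using w1_nonneg by (simp add: w ennreal_leI flip: ennreal_mult)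
      then show ?thesis
        using \<open>x \<in> ?S\<close> False by simp
    qed auto
  qed
  also have "\<dots> = ?D + ennreal (y powr \<alpha>) * distrib_fun w (\<lambda>x. ennreal \<bar>g x\<bar>) y"
    unfolding distrib_fun_def by (subst nn_integral_add) (auto simp: nn_integral_cmult)
  also have "\<dots> \<le> ?D + ennreal (y powr \<alpha>) * (ennreal (B powr p\<^sub>0 / y powr p\<^sub>0) *
      (\<integral>\<^sup>+x. epow (ennreal \<bar>f x\<bar>) p\<^sub>0 * ennreal (w x) \<partial>lebesgue))"
  proof (intro add_left_mono mult_left_mono distrib_fun_le_of_weak_Lp_norm y B)
    show "weak_Lp_norm p\<^sub>0 w g \<le> ennreal B * Lp_norm p\<^sub>0 w f"
      using Ap_factorization[OF w1 _ w2 _ p] C1 C2 by (intro weak) (auto simp: w_def)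
  qed (use par in auto)
  also have "(\<integral>\<^sup>+x. epow (ennreal \<bar>f x\<bar>) p\<^sub>0 * ennreal (w x) \<partial>lebesgue) \<le> ?J"
  proof (rule nn_integral_mono_AE, use m in eventually_elim)
    fix x assume mx: "0 < m x \<and> maximal_pow r f x = ennreal (m x powr r) \<and> f x \<le> m x powr r"
    show "epow (ennreal \<bar>f x\<bar>) p\<^sub>0 * ennreal (w x) \<le> epow (ennreal (f x)) (p\<^sub>0 - \<alpha>) * maximal_pow \<mu> h x"
    proof (cases "f x = 0")
      case True
      then show ?thesis using par by (simp add: epow_def)
    next
      case False
      then have fx: "0 < f x" using f(2)[of x] by simp
      have epow_f: "epow (ennreal (f x)) s = ennreal (f x powr s)" for s
        using fx by (simp add: epow_def)
      have "f x powr \<alpha> \<le> (m x powr r) powr \<alpha>"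
        using fx mx par by (intro powr_mono2) auto
      also have "\<dots> = m x powr (r * \<alpha>)" by (simp add: powr_powr)
      finally have "f x powr \<alpha> * m x powr (- (r * \<alpha>)) \<le> 1"
        using mx by (simp add: powr_minus field_simps)
      then have "(f x powr (p\<^sub>0 - \<alpha>) * w1 x) * (f x powr \<alpha> * m x powr (- (r * \<alpha>))) \<le> (f x powr (p\<^sub>0 - \<alpha>) * w1 x) * 1"
        using w1_nonneg by (intro mult_left_mono) auto
      moreover have "f x powr p\<^sub>0 = f x powr (p\<^sub>0 - \<alpha>) * f x powr \<alpha>"
        by (simp flip: powr_add)
      ultimately have "f x powr p\<^sub>0 * w x \<le> f x powr (p\<^sub>0 - \<alpha>) * w1 x"
        by (simp add: w mult_ac)
      then show ?thesis
        using fx w1_nonneg by (simp add: epow_f w1_eq w ennreal_leI flip: ennreal_mult)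
    qed
  qed
  also have "ennreal (y powr \<alpha>) * (ennreal (B powr p\<^sub>0 / y powr p\<^sub>0) * ?J) =
      ennreal (B powr p\<^sub>0) * (ennreal (1 / y powr (p\<^sub>0 - \<alpha>)) * ?J)"
    using y by (simp add: powr_diff mult.assoc[symmetric] flip: ennreal_mult) (simp add: mult.commute)
  finally show ?thesis
    by (simp add: add_left_mono mult_left_mono)
qed

section \<open>Choice of the constants, degenerate cases and truncation\<close>

theorem theorem2p3:
  fixes p\<^sub>0 \<alpha> \<mu> r :: real and \<phi> :: "real \<Rightarrow> real"
  assumes "1 \<le> p\<^sub>0" and "0 \<le> \<alpha>" and "\<alpha> \<le> p\<^sub>0" and "0 < \<mu>" and "\<mu> < 1" and "0 < r"
    and "locally_bounded \<phi>"
  shows "\<exists>C::real. 0 < C \<and>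
    (\<forall>(f :: real ^ 'n \<Rightarrow> real) (g :: real ^ 'n \<Rightarrow> real).
       f \<in> borel_measurable lebesgue \<longrightarrow> g \<in> borel_measurable lebesgue \<longrightarrow>
       (\<forall>x. 0 \<le> f x) \<longrightarrow> (\<forall>x. 0 \<le> g x) \<longrightarrow>
       (\<forall>w \<in> Ainfty. weak_Lp_norm p\<^sub>0 w g \<le> ennreal (\<phi> (Ainfty_const w)) * Lp_norm p\<^sub>0 w f) \<longrightarrow>
       (\<forall>(u :: real ^ 'n \<Rightarrow> real) y.
          locally_integrable u \<longrightarrow> (\<forall>x. 0 \<le> u x) \<longrightarrow> 0 < y \<longrightarrow>
          distrib_fun u (\<lambda>x. ennreal \<bar>g x\<bar>) y \<le>
            ennreal C * (distrib_fun u (maximal_pow r f) y +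
              ennreal (1 / y powr (p\<^sub>0 - \<alpha>)) *
              (\<integral>\<^sup>+x. epow (ennreal (f x)) (p\<^sub>0 - \<alpha>) *
                     maximal_pow \<mu> (\<lambda>z. u z * indicator {z. g z > y} z) x \<partial>lebesgue))))"
proof -
  \<comment> \<open>Any p > 1 with r * \<alpha> < p - 1 would do; here p - 1 = 1 + 2 * (r *
    \<alpha>), so \<delta> < 1/2, and \<alpha> = 0 is included.\<close>
  define p where "p = 2 + 2 * (r * \<alpha>)"
  define \<delta> where "\<delta> = r * \<alpha> / (p - 1)"
  have r\<alpha>: "0 \<le> r * \<alpha>" using assms by simp
  then have p: "1 < p" and \<delta>: "0 \<le> \<delta>" "\<delta> < 1" "\<delta> * (p - 1) = r * \<alpha>"
    by (auto simp: p_def \<delta>_def field_simps)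
  obtain C1 where C1: "1 \<le> C1"
    "\<And>(f :: real ^ 'n \<Rightarrow> real) Q x. f \<in> borel_measurable lebesgue \<Longrightarrow> Q \<in> cubes \<Longrightarrow> x \<in> Q \<Longrightarrow>
      (\<integral>\<^sup>+z\<in>Q. epow (maximal f z) \<mu> \<partial>lebesgue) \<le> ennreal C1 * epow (maximal f x) \<mu> * emeasure lebesgue Q"
    using \<open>0 < \<mu>\<close> \<open>\<mu> < 1\<close> by (rule maximal_powr_A1[OF less_imp_le]) (rule that)
  obtain C2 where C2: "1 \<le> C2"
    "\<And>(f :: real ^ 'n \<Rightarrow> real) Q x. f \<in> borel_measurable lebesgue \<Longrightarrow> Q \<in> cubes \<Longrightarrow> x \<in> Q \<Longrightarrow>
      (\<integral>\<^sup>+z\<in>Q. epow (maximal f z) \<delta> \<partial>lebesgue) \<le> ennreal C2 * epow (maximal f x) \<delta> * emeasure lebesgue Q"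
    using \<delta>(1,2) by (rule maximal_powr_A1) (rule that)
  \<comment> \<open>The bound for the A_p constant, hence for the A_\<infinity> constant, of every
    weight to be used. It is fixed before f, g, u and y.\<close>
  define K where "K = C1 * C2 powr (p - 1)"
  have K: "0 < K" using C1 C2 by (simp add: K_def)
  \<comment> \<open>Local boundedness concerns open intervals, whereas the constants satisfy only
    \<le> K; hence K + 1.\<close>
  then have "bdd_above (\<phi> ` {0<..<K + 1})"
    using \<open>locally_bounded \<phi>\<close> by (simp add: locally_bounded_def)
  then obtain B0 where "\<forall>t\<in>{0<..<K + 1}. \<phi> t \<le> B0"
    unfolding bdd_above_def by blast
  then have B0: "\<phi> t \<le> B0" if "0 < t" "t < K + 1" for t
    using that by simp
  \<comment> \<open>The maximum with 1 ensures positivity, since \<open>B0\<close> may be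
    nonpositive.\<close>
  define B where "B = max 1 B0"
  have B: "0 < B" by (simp add: B_def)
  define C where "C = 1 + B powr p\<^sub>0"
  have C: "1 \<le> C" "B powr p\<^sub>0 \<le> C" by (auto simp: C_def)
  show ?thesis
  proof (intro exI[of _ C] conjI allI impI)
    show "0 < C" using C by simp
    fix f g u :: "real ^ 'n \<Rightarrow> real" and y :: real
    assume f[measurable]: "f \<in> borel_measurable lebesgue" and g[measurable]: "g \<in> borel_measurable lebesgue"
      and f0: "\<forall>x. 0 \<le> f x" and g0: "\<forall>x. 0 \<le> g x"
      and hyp: "\<forall>w \<in> Ainfty. weak_Lp_norm p\<^sub>0 w g \<le> ennreal (\<phi> (Ainfty_const w)) * Lp_norm p\<^sub>0 w f"
      and u: "locally_integrable u" and u0: "\<forall>x. 0 \<le> u x" and y: "0 < y"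
    have [measurable]: "u \<in> borel_measurable lebesgue"
      using u by (simp add: locally_integrable_def)
    let ?S = "{x. ennreal y < ennreal \<bar>g x\<bar>}"
    have S: "x \<in> ?S \<longleftrightarrow> y < g x" for x
      using y g0 by (simp add: ennreal_less_iff)
    let ?D = "distrib_fun u (maximal_pow r f) y"
    let ?J = "\<integral>\<^sup>+x. epow (ennreal (f x)) (p\<^sub>0 - \<alpha>) *
      maximal_pow \<mu> (\<lambda>z. u z * indicator {z. g z > y} z) x \<partial>lebesgue"
    let ?R = "ennreal (1 / y powr (p\<^sub>0 - \<alpha>)) * ?J"
    let ?G = "\<lambda>z. \<bar>f z\<bar> powr (1 / r)"
    have D_le: "?D \<le> ennreal C * (?D + ?R)"
    proof -
      have "1 * (?D + 0) \<le> ennreal C * (?D + ?R)"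
        using C by (intro mult_mono add_mono) (auto simp flip: ennreal_1 intro!: ennreal_leI)
      then show ?thesis by simp
    qed
    show "distrib_fun u (\<lambda>x. ennreal \<bar>g x\<bar>) y \<le> ennreal C * (?D + ?R)"
    proof (cases "\<exists>x0. maximal ?G x0 < \<infinity>")
      case False
      then have "maximal_pow r f x = \<infinity>" for x
        using \<open>0 < r\<close> by (auto simp: maximal_pow_def epow_def top.not_eq_extremum)
      then have "distrib_fun u (\<lambda>x. ennreal \<bar>g x\<bar>) y \<le> ?D"
        unfolding distrib_fun_def by (intro nn_integral_mono) (auto simp: indicator_def)
      then show ?thesis using D_le by (rule order_trans)
    next
      case True
      then obtain x0 where x0: "maximal ?G x0 < \<infinity>" by blast
      show ?thesis
      proof (cases "maximal ?G x0 = 0")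
        case True
        have "?G \<in> borel_measurable lebesgue" by measurable
        then have "AE x in lebesgue. ?G x = 0"
          using True by (rule AE_eq_0_if_maximal_eq_0)
        then have "AE x in lebesgue. epow (ennreal \<bar>f x\<bar>) p\<^sub>0 * ennreal 1 = 0"
          by eventually_elim (use \<open>1 \<le> p\<^sub>0\<close> in \<open>simp add: epow_def\<close>)
        then have I0: "(\<integral>\<^sup>+x. epow (ennreal \<bar>f x\<bar>) p\<^sub>0 * ennreal 1 \<partial>lebesgue) = 0"
          by (subst nn_integral_0_iff_AE) auto
        let ?one = "\<lambda>_ :: real ^ 'n. 1 :: real"
        have "?one \<in> Ainfty"
          unfolding Ainfty_def using one_in_Ap by (intro UN_I[of 2]) auto
        then have "weak_Lp_norm p\<^sub>0 ?one g \<le> ennreal (\<phi> (Ainfty_const ?one)) * Lp_norm p\<^sub>0 ?one f"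
          using hyp by blast
        \<comment> \<open>The norm of f is 0, so any factor may stand here; 1 is positive, as
          \<open>distrib_fun_le_of_weak_Lp_norm\<close> requires.\<close>
        also have "\<dots> \<le> ennreal 1 * Lp_norm p\<^sub>0 ?one f"
          using I0 \<open>1 \<le> p\<^sub>0\<close> by (simp add: Lp_norm_def epow_0_left)
        finally have "distrib_fun ?one (\<lambda>x. ennreal \<bar>g x\<bar>) y \<le> 0"
          using distrib_fun_le_of_weak_Lp_norm[of p\<^sub>0 1 y ?one g f] I0 y \<open>1 \<le> p\<^sub>0\<close> by simp
        then have "AE x in lebesgue. ennreal 1 * indicator ?S x = 0"
          unfolding distrib_fun_def by (subst (asm) le_zero_eq, subst (asm) nn_integral_0_iff_AE) auto
        then have "AE x in lebesgue. ennreal (u x) * indicator ?S x = 0"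
          by eventually_elim auto
        then have "distrib_fun u (\<lambda>x. ennreal \<bar>g x\<bar>) y = 0"
          unfolding distrib_fun_def by (subst nn_integral_0_iff_AE) auto
        then show ?thesis by simp
      next
        case False
        \<comment> \<open>Truncating u at N makes the function bounded; the resulting bound does not
          depend on N, and monotone convergence restores u.\<close>
        define h where "h N x = min (u x) (real N) * indicator {x. g x > y} x" for N :: nat and x
        have h_meas[measurable]: "h N \<in> borel_measurable lebesgue" for N
        proof -
          have "{x \<in> space lebesgue. g x > y} \<in> sets lebesgue" by measurable
          then have [measurable]: "{x. g x > y} \<in> sets lebesgue" by simp
          show ?thesis unfolding h_def by measurable
        qed
        have h: "0 \<le> h N x" "h N x \<le> real N" "g x \<le> y \<Longrightarrow> h N x = 0" "h N x \<le> u x * indicator {x. g x > y} x"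
          for N x
          using u0 by (auto simp: h_def indicator_def)
        have h_le_u: "h N x \<le> u x" for N x
          using u0 by (auto simp: h_def indicator_def)
        \<comment> \<open>The hypothesis on f and g, with \<phi> replaced by the uniform bound B on
          the weights whose A_p constant is at most K.\<close>
        have weak: "weak_Lp_norm p\<^sub>0 w g \<le> ennreal B * Lp_norm p\<^sub>0 w f"
          if w: "w \<in> Ap p" "Ap_const p w \<le> ennreal (C1 * C2 powr (p - 1))" for w
        proof -
          have "ennreal (Ainfty_const w) \<le> ennreal K"
            using Ainfty_const_le_Ap_const(2)[OF w(1) p] w(2) unfolding K_def by (rule order_trans)
          then have "Ainfty_const w \<le> K" using K by simp
          then have "\<phi> (Ainfty_const w) \<le> B"
            using B0[of "Ainfty_const w"] Ainfty_const_le_Ap_const(1)[OF w(1) p] by (simp add: B_def)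
          moreover have "w \<in> Ainfty"
            using w(1) p by (auto simp: Ainfty_def)
          ultimately show ?thesis
            using hyp by (meson ennreal_leI mult_right_mono order_trans zero_le)
        qed
        have h_int: "(\<integral>\<^sup>+x. ennreal (h N x) \<partial>lebesgue) \<le> ennreal C * (?D + ?R)" for N
        proof -
          have "(\<integral>\<^sup>+x. ennreal (h N x) \<partial>lebesgue) \<le> distrib_fun (h N) (maximal_pow r f) y +
            ennreal (B powr p\<^sub>0) * (ennreal (1 / y powr (p\<^sub>0 - \<alpha>)) *
              (\<integral>\<^sup>+x. epow (ennreal (f x)) (p\<^sub>0 - \<alpha>) * maximal_pow \<mu> (h N) x \<partial>lebesgue))"
            using f0 g0 h
            by (intro bounded_function_estimate[where p=p and \<delta>=\<delta> and ?C1.0=C1 and ?C2.0=C2 and N="real N"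
                and g=g and ?x0.0=x0]
              assms f g h_meas y B p \<delta> x0 False weak C1(1) C2(1) C1(2) C2(2)) auto
          also have "\<dots> \<le> ?D + ennreal (B powr p\<^sub>0) * ?R"
          proof (intro add_mono mult_left_mono nn_integral_mono maximal_pow_mono)
            show "distrib_fun (h N) (maximal_pow r f) y \<le> ?D"
              unfolding distrib_fun_def
              using h_le_u by (intro nn_integral_mono mult_right_mono ennreal_leI) auto
            show "\<bar>h N x\<bar> \<le> \<bar>u x * indicator {z. g z > y} x\<bar>" for x
              using h(1)[of N x] h(4)[of N x] by simp
          qed (use \<open>0 < \<mu>\<close> in auto)
          also have "\<dots> \<le> ennreal C * ?D + ennreal C * ?R"
          proof (intro add_mono mult_right_mono)
            have "1 * ?D \<le> ennreal C * ?D"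
              using C by (intro mult_right_mono) (auto simp flip: ennreal_1 intro!: ennreal_leI)
            then show "?D \<le> ennreal C * ?D" by simp
          qed (use C in \<open>auto intro!: ennreal_leI\<close>)
          finally show ?thesis by (simp add: distrib_left)
        qed
        have "distrib_fun u (\<lambda>x. ennreal \<bar>g x\<bar>) y \<le> (\<integral>\<^sup>+x. (SUP N. ennreal (h N x)) \<partial>lebesgue)"
          unfolding distrib_fun_def
        proof (rule nn_integral_mono)
          fix x
          obtain N :: nat where N: "u x \<le> N"
            using real_arch_simple by blast
          then have "ennreal (u x) * indicator ?S x = ennreal (h N x)"
            using S[of x] by (auto simp: h_def indicator_def)
          also have "\<dots> \<le> (SUP N. ennreal (h N x))"
            by (rule SUP_upper) simp
          finally show "ennreal (u x) * indicator ?S x \<le> (SUP N. ennreal (h N x))" .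
        qed
        also have "\<dots> = (SUP N. \<integral>\<^sup>+x. ennreal (h N x) \<partial>lebesgue)"
        proof (rule nn_integral_monotone_convergence_SUP)
          show "incseq (\<lambda>N x. ennreal (h N x))"
            by (auto simp: incseq_def le_fun_def h_def indicator_def intro!: ennreal_leI)
        qed measurable
        also have "\<dots> \<le> ennreal C * (?D + ?R)"
          by (rule SUP_least) (rule h_int)
        finally show ?thesis .
      qed
    qed
  qed
qed

end
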